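(* Let $\mathcal{G}$ be a multigraph of order $n\ge 2$ (i.e. with $n$ vertices), $n\neq 4$, and let $\lambda$ be the maximum number of edges between any two vertices of $\mathcal{G}$. Then $$h_t(\mathcal{G})\le (\lambda-1)\left(2\left\lceil \tfrac{n}{2}\right\rceil-1\right)+\left\lceil \tfrac{3n}{2}\right\rceil .$$
   Context: Multigraphs are finite and loopless; several parallel edges may join the same pair of vertices. A total colouring of a multigraph $\mathcal{G}$ is an assignment of colours to both the vertices and the edges of $\mathcal{G}$ (from a common set of colours) such that adjacent vertices receive different colours, adjacent edges (distinct edges sharing at least one endpoint, in particular parallel edges) receive different colours, and every edge receives a colour different from the colours of its end vertices. A harmonious total colouring of $\mathcal{G}$ is a total colouring $c$ with the additional property that, when for each incident pair $(v,e)$ of a vertex $v$ and an edge $e$ one writes the unordered pair of colours $\{c(v),c(e)\}$, each unordered pair of colours occurs at most once; that is, for distinct incident pairs $(v,e)\ne(w,f)$ one has $\{c(v),c(e)\}\neq\{c(w),c(f)\}$. The harmonious total chromatic number $h_t(\mathcal{G})$ is the smallest number of colours in a harmonious total colouring of $\mathcal{G}$. The right-hand side of the bound is computed in the integers (so $\lambda-1$ is ordinary integer subtraction). *)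

theory Defs
  imports Complex_Main
begin

record ('v, 'e) pre_multigraph =
  verts :: "'v set"
  edges :: "'e set"
  ends :: "'e \<Rightarrow> 'v set"

text \<open>
  Edges are objects of their own, so parallel edges are distinct edges with the same set of ends;
  a set of ends has exactly two elements, which excludes loops.
\<close>

locale multigraph =
  fixes G :: "('v, 'e) pre_multigraph"
  assumes finite_verts: "finite (verts G)"
    and finite_edges: "finite (edges G)"
    and ends_subset: "e \<in> edges G \<Longrightarrow> ends G e \<subseteq> verts G"
    and card_ends: "e \<in> edges G \<Longrightarrow> card (ends G e) = 2"

definition order :: "('v, 'e) pre_multigraph \<Rightarrow> nat" where
  "order G = card (verts G)"

definition edges_between :: "('v, 'e) pre_multigraph \<Rightarrow> 'v \<Rightarrow> 'v \<Rightarrow> 'e set" where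
  "edges_between G u v = {e \<in> edges G. ends G e = {u, v}}"

definition max_multiplicity :: "('v, 'e) pre_multigraph \<Rightarrow> nat" where
  "max_multiplicity G =
     Max {card (edges_between G u v) |u v. u \<in> verts G \<and> v \<in> verts G \<and> u \<noteq> v}"

definition adjacent_verts :: "('v, 'e) pre_multigraph \<Rightarrow> 'v \<Rightarrow> 'v \<Rightarrow> bool" where
  "adjacent_verts G u v \<longleftrightarrow> u \<noteq> v \<and> (\<exists>e \<in> edges G. ends G e = {u, v})"

definition adjacent_edges :: "('v, 'e) pre_multigraph \<Rightarrow> 'e \<Rightarrow> 'e \<Rightarrow> bool" where
  "adjacent_edges G e f \<longleftrightarrow>
     e \<in> edges G \<and> f \<in> edges G \<and> e \<noteq> f \<and> ends G e \<inter> ends G f \<noteq> {}"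

definition incident_pairs :: "('v, 'e) pre_multigraph \<Rightarrow> ('v \<times> 'e) set" where
  "incident_pairs G = {(v, e). v \<in> verts G \<and> e \<in> edges G \<and> v \<in> ends G e}"

text \<open>
  A colouring acts on the disjoint sum of vertices and edges: \<open>c (Inl v)\<close> is the colour of the
  vertex \<open>v\<close> and \<open>c (Inr e)\<close> the colour of the edge \<open>e\<close>.
\<close>

definition total_colouring :: "('v, 'e) pre_multigraph \<Rightarrow> ('v + 'e \<Rightarrow> 'c) \<Rightarrow> bool" where
  "total_colouring G c \<longleftrightarrow>
     (\<forall>u v. adjacent_verts G u v \<longrightarrow> c (Inl u) \<noteq> c (Inl v)) \<and>
     (\<forall>e f. adjacent_edges G e f \<longrightarrow> c (Inr e) \<noteq> c (Inr f)) \<and>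
     (\<forall>(v, e) \<in> incident_pairs G. c (Inl v) \<noteq> c (Inr e))"

definition harmonious_total_colouring ::
    "('v, 'e) pre_multigraph \<Rightarrow> ('v + 'e \<Rightarrow> 'c) \<Rightarrow> bool" where
  "harmonious_total_colouring G c \<longleftrightarrow>
     total_colouring G c \<and>
     inj_on (\<lambda>(v, e). {c (Inl v), c (Inr e)}) (incident_pairs G)"

definition num_colours :: "('v, 'e) pre_multigraph \<Rightarrow> ('v + 'e \<Rightarrow> 'c) \<Rightarrow> nat" where
  "num_colours G c = card (c ` (verts G <+> edges G))"

text \<open>
  Only finitely many colours are ever used, so natural numbers suffice as colours. The minimum is
  attained by \<open>harmonious_total_chromatic_number_attained\<close> below.
\<close>

definition harmonious_total_chromatic_number :: "('v, 'e) pre_multigraph \<Rightarrow> nat" where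
  "harmonious_total_chromatic_number G =
     (LEAST k. \<exists>c :: 'v + 'e \<Rightarrow> nat. harmonious_total_colouring G c \<and> num_colours G c = k)"

lemma (in multigraph) harmonious_total_colouring_exists:
  "\<exists>c :: 'v + 'e \<Rightarrow> nat. harmonious_total_colouring G c"
proof -
  have "finite (verts G <+> edges G)"
    using finite_verts finite_edges by simp
  then obtain c :: "'v + 'e \<Rightarrow> nat" where c: "inj_on c (verts G <+> edges G)"
    using finite_imp_inj_to_nat_seg by blast
  have vv: "c (Inl u) = c (Inl v) \<longleftrightarrow> u = v" if "u \<in> verts G" "v \<in> verts G" for u v
    using inj_on_eq_iff[OF c] that by auto
  have ee: "c (Inr e) = c (Inr f) \<longleftrightarrow> e = f" if "e \<in> edges G" "f \<in> edges G" for e f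
    using inj_on_eq_iff[OF c] that by auto
  have ve: "c (Inl v) \<noteq> c (Inr e)" if "v \<in> verts G" "e \<in> edges G" for v e
    using inj_on_eq_iff[OF c] that by auto
  have adj: "u \<in> verts G \<and> v \<in> verts G \<and> u \<noteq> v" if "adjacent_verts G u v" for u v
    using that ends_subset unfolding adjacent_verts_def by blast
  have "total_colouring G c"
    unfolding total_colouring_def
    using adj by (auto simp: vv ee ve incident_pairs_def adjacent_edges_def)
  moreover have "inj_on (\<lambda>(v, e). {c (Inl v), c (Inr e)}) (incident_pairs G)"
  proof (rule inj_onI, clarsimp simp: incident_pairs_def)
    fix v e w f
    assume "{c (Inl v), c (Inr e)} = {c (Inl w), c (Inr f)}"
      and "v \<in> verts G" "e \<in> edges G" "w \<in> verts G" "f \<in> edges G"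
    then show "v = w \<and> e = f"
      by (metis doubleton_eq_iff vv ee ve)
  qed
  ultimately show ?thesis
    unfolding harmonious_total_colouring_def by blast
qed

lemma (in multigraph) harmonious_total_chromatic_number_attained:
  "\<exists>c :: 'v + 'e \<Rightarrow> nat. harmonious_total_colouring G c \<and>
     num_colours G c = harmonious_total_chromatic_number G"
  unfolding harmonious_total_chromatic_number_def
  by (rule LeastI_ex) (use harmonious_total_colouring_exists in blast)

end

theory Submission
  imports Defs "HOL-Number_Theory.Cong"
begin

text \<open>
  It is enough to colour the complete graph on \<open>n\<close> vertices with the vertices themselves as vertex
  colours and \<open>q = \<lceil>n/2\<rceil>\<close> extra colours on edges. Choose one edge of each parallel class and colour
  these edges as in the complete graph; every further layer of parallel edges gets its own
  \<open>2\<lceil>n/2\<rceil> - 1\<close> fresh colours, used as in a proper edge colouring of the complete graph. A pair of a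
  vertex colour and a colour that no vertex has determines its vertex, and then its edge by
  properness. So only the edges that carry vertex colours matter: if an edge at \<open>v\<close> has the colour \<open>w\<close>,
  draw an arc \<open>v \<rightarrow> w\<close>. The colouring is harmonious exactly if it is proper and never contains both
  \<open>v \<rightarrow> w\<close> and \<open>w \<rightarrow> v\<close>. As an edge with a vertex colour uses up two of the \<open>n(n-1)/2\<close> pairs of
  vertices, this leaves little room.
  
  For \<open>n = 2m\<close> write the vertices as \<open>x\<^sub>i\<close> and \<open>y\<^sub>i\<close> with \<open>i < m\<close>. The two cliques and the rungs
  \<open>x\<^sub>iy\<^sub>i\<close> are coloured with \<open>m\<close> extra colours by the sum of the two indices modulo \<open>m\<close>. What remains
  is the crown, the edges \<open>x\<^sub>iy\<^sub>j\<close> with \<open>i \<noteq> j\<close>, and they get vertex colours. For \<open>n = 2m + 1\<close> there is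
  a further vertex \<open>\<infinity>\<close>: for each \<open>i\<close> one of \<open>\<infinity>x\<^sub>i\<close>, \<open>\<infinity>y\<^sub>i\<close> joins the crown and the other one is coloured
  by sums modulo \<open>m + 1\<close>, where \<open>\<infinity>\<close> counts as \<open>0\<close> (\<open>complete_harmonious_even\<close>,
  \<open>complete_harmonious_odd\<close>).
  
  The crown is coloured by a betweenness principle (\<open>betweenness_harmonious\<close>). Let \<open>T\<close> be a tournament
  on the indices and let \<open>L\<close> be a Latin square such that \<open>k = L i j\<close> always lies on a directed path
  \<open>i, k, j\<close> or \<open>j, k, i\<close>. Then \<open>x\<^sub>iy\<^sub>j\<close> gets the colour \<open>x\<^sub>k\<close> or \<open>y\<^sub>k\<close>, according to the direction; the
  arcs between the pairs \<open>{x\<^sub>i, y\<^sub>i}\<close> and \<open>{x\<^sub>k, y\<^sub>k}\<close> then form a directed \<open>4\<close>-cycle. For odd \<open>m\<close> the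
  midpoint in \<open>\<int>\<^sub>m\<close> and a rotational tournament do this. For even \<open>m\<close> it is impossible on all cells,
  since \<open>T\<close> would have to be regular, but the principle still covers the bulk of the cells, and the
  rest splits into smaller crowns or into finitely many cyclic orbits:
  \<open>m = 4t\<close> with \<open>t\<close> odd comes from \<open>m = 4\<close> (\<open>has_crown_mult_odd\<close>), \<open>m = 8w\<close> with \<open>w \<ge> 2\<close> from \<open>2w\<close>
  by the affine plane of order \<open>3\<close> (\<open>has_crown_mult_4\<close>), \<open>m = 2r\<close> with \<open>r \<ge> 5\<close> odd from \<open>\<int>\<^sub>r\<close> with
  \<open>16\<close> exceptional orbits of cells (\<open>has_crown_double_odd\<close>), and \<open>m = 4, 6, 8\<close> from tables. The crown with
  \<open>m = 2\<close> has no such colouring; this is the excluded \<open>n = 4\<close>, and \<open>n = 5\<close> is coloured directly.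
\<close>

section \<open>Crown colourings\<close>

text \<open>
  The vertices \<open>x\<^sub>i\<close> and \<open>y\<^sub>i\<close> are \<open>(False, i)\<close> and \<open>(True, i)\<close>. The cell \<open>(i, j)\<close> with \<open>i \<noteq> j\<close> is the edge
  \<open>x\<^sub>iy\<^sub>j\<close>. The diagonal cell \<open>(i, i)\<close> is not the rung \<open>x\<^sub>iy\<^sub>i\<close> but the edge from the further vertex \<open>\<infinity>\<close>
  to \<open>x\<^sub>i\<close> or \<open>y\<^sub>i\<close>, as \<open>b i\<close> says; since \<open>\<infinity>\<close> never occurs as a colour, it is left out of the ends.
\<close>

definition cell_ends :: "('i \<Rightarrow> bool) \<Rightarrow> 'i \<times> 'i \<Rightarrow> (bool \<times> 'i) set" where
  "cell_ends b = (\<lambda>(i, j). if i = j then {(b i, i)} else {(False, i), (True, j)})"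

text \<open>
  A common end with equal colours is forbidden, and so is a pair of arcs \<open>v \<rightarrow> w\<close>, \<open>w \<rightarrow> v\<close>, where
  \<open>v \<rightarrow> w\<close> means that some cell with end \<open>v\<close> has the colour \<open>w\<close>. Together this says that no pair of
  colours occurs twice. The second condition with \<open>e = f\<close> keeps a cell from having the colour of one
  of its own ends.
\<close>

definition harmonious_on :: "('i \<Rightarrow> bool) \<Rightarrow> ('i \<times> 'i) set \<Rightarrow> ('i \<times> 'i \<Rightarrow> bool \<times> 'i) \<Rightarrow> bool" where
  "harmonious_on b E C \<longleftrightarrow>
     (\<forall>e\<in>E. \<forall>f\<in>E. C e = C f \<and> cell_ends b e \<inter> cell_ends b f \<noteq> {} \<longrightarrow> e = f) \<and>
     (\<forall>e\<in>E. \<forall>f\<in>E. \<not> (C f \<in> cell_ends b e \<and> C e \<in> cell_ends b f))"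

text \<open>
  The diagonal cells are the edges at \<open>\<infinity>\<close>, so they must have distinct colours.
\<close>

definition crown :: "'i set \<Rightarrow> ('i \<Rightarrow> bool) \<Rightarrow> ('i \<times> 'i \<Rightarrow> bool \<times> 'i) \<Rightarrow> bool" where
  "crown I b C \<longleftrightarrow>
     (\<forall>e\<in>I \<times> I. snd (C e) \<in> I) \<and> harmonious_on b (I \<times> I) C \<and> inj_on (\<lambda>i. C (i, i)) I"

definition has_crown :: "nat \<Rightarrow> bool" where
  "has_crown m \<longleftrightarrow> (\<exists>b C. crown {..<m} b C)"

lemma cell_ends_diag [simp]: "cell_ends b (i, i) = {(b i, i)}"
  and cell_ends_off: "i \<noteq> j \<Longrightarrow> cell_ends b (i, j) = {(False, i), (True, j)}"
  by (simp_all add: cell_ends_def)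

lemma harmonious_onI:
  assumes "\<And>e f v. e \<in> E \<Longrightarrow> f \<in> E \<Longrightarrow> v \<in> cell_ends b e \<Longrightarrow> v \<in> cell_ends b f \<Longrightarrow> C e = C f \<Longrightarrow> e = f"
    and "\<And>e f. e \<in> E \<Longrightarrow> f \<in> E \<Longrightarrow> C f \<in> cell_ends b e \<Longrightarrow> C e \<in> cell_ends b f \<Longrightarrow> False"
  shows "harmonious_on b E C"
  using assms unfolding harmonious_on_def by fast

lemma harmonious_onD:
  assumes "harmonious_on b E C" "e \<in> E" "f \<in> E"
  shows "v \<in> cell_ends b e \<Longrightarrow> v \<in> cell_ends b f \<Longrightarrow> C e = C f \<Longrightarrow> e = f"
    and "C f \<in> cell_ends b e \<Longrightarrow> C e \<in> cell_ends b f \<Longrightarrow> False"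
  using assms unfolding harmonious_on_def by fast+

lemma snd_cell_ends: "v \<in> cell_ends b (i, j) \<Longrightarrow> snd v = i \<or> snd v = j"
  by (auto simp: cell_ends_def split: if_splits)

lemma crown_transport:
  assumes f: "bij_betw f I J" and C: "crown J b C"
  shows "\<exists>b C. crown I b C"
proof -
  define h where "h = (\<lambda>e :: 'a \<times> 'a. (f (fst e), f (snd e)))"
  define b' where "b' = b \<circ> f"
  define C' where "C' = (\<lambda>e. (fst (C (h e)), inv_into I f (snd (C (h e)))))"
  have fI: "f i \<in> J" if "i \<in> I" for i
    using f that by (auto simp: bij_betw_def)
  have inj: "i = j" if "f i = f j" "i \<in> I" "j \<in> I" for i j
    using f that by (auto simp: bij_betw_def inj_on_def)
  have h: "h e \<in> J \<times> J" if "e \<in> I \<times> I" for e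
    using that fI by (auto simp: h_def)
  have injh: "e = e'" if "h e = h e'" "e \<in> I \<times> I" "e' \<in> I \<times> I" for e e'
    using that inj by (auto simp: h_def prod_eq_iff)
  have snd_C: "snd (C (h e)) \<in> f ` I" if "e \<in> I \<times> I" for e
    using C h[OF that] f unfolding crown_def bij_betw_def by auto
  have C'1: "snd (C' e) \<in> I" if "e \<in> I \<times> I" for e
    using snd_C[OF that] by (simp add: C'_def inv_into_into)
  have C'2: "(fst (C' e), f (snd (C' e))) = C (h e)" if "e \<in> I \<times> I" for e
    using snd_C[OF that] by (simp add: C'_def f_inv_into_f)
  have ends: "(fst v, f (snd v)) \<in> cell_ends b (h e)" if "v \<in> cell_ends b' e" "e \<in> I \<times> I" for v e
  proof (cases "fst e = snd e")
    case True
    with that show ?thesis by (cases e) (simp add: h_def b'_def)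
  next
    case False
    moreover have "f (fst e) \<noteq> f (snd e)"
      using False that inj by auto
    ultimately show ?thesis
      using that(1) by (cases e) (auto simp: h_def cell_ends_off)
  qed
  have H: "harmonious_on b (J \<times> J) C"
    using C by (simp add: crown_def)
  have "harmonious_on b' (I \<times> I) C'"
  proof (rule harmonious_onI)
    fix e e' v assume e: "e \<in> I \<times> I" and e': "e' \<in> I \<times> I"
      and v: "v \<in> cell_ends b' e" "v \<in> cell_ends b' e'" and eq: "C' e = C' e'"
    have "C (h e) = C (h e')"
      using C'2[OF e] C'2[OF e'] eq by simp
    then have "h e = h e'"
      by (rule harmonious_onD(1)[OF H h[OF e] h[OF e'] ends[OF v(1) e] ends[OF v(2) e']])
    then show "e = e'" by (rule injh[OF _ e e'])
  next
    fix e e' assume e: "e \<in> I \<times> I" and e': "e' \<in> I \<times> I"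
      and eq: "C' e' \<in> cell_ends b' e" "C' e \<in> cell_ends b' e'"
    have "C (h e') \<in> cell_ends b (h e)" "C (h e) \<in> cell_ends b (h e')"
      using ends[OF eq(1) e] ends[OF eq(2) e'] C'2[OF e] C'2[OF e'] by simp_all
    then show False
      by (rule harmonious_onD(2)[OF H h[OF e] h[OF e']])
  qed
  moreover have "inj_on (\<lambda>i. C' (i, i)) I"
  proof (rule inj_onI)
    fix i j assume i: "i \<in> I" and j: "j \<in> I" and ij: "C' (i, i) = C' (j, j)"
    have "C (f i, f i) = C (f j, f j)"
      using C'2[of "(i, i)"] C'2[of "(j, j)"] i j ij by (simp add: h_def)
    then have "f i = f j"
      using C fI[OF i] fI[OF j] unfolding crown_def inj_on_def by blast
    then show "i = j" using inj i j by blast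
  qed
  ultimately have "crown I b' C'"
    using C'1 unfolding crown_def by blast
  then show ?thesis by blast
qed

lemma has_crown_iff:
  assumes "finite I"
  shows "has_crown (card I) \<longleftrightarrow> (\<exists>b C. crown I b C)"
proof
  obtain f where f: "bij_betw f I {..<card I}"
    using assms ex_bij_betw_finite_nat[of I] by (auto simp: atLeast0LessThan)
  show "\<exists>b C. crown I b C" if "has_crown (card I)"
    using that crown_transport[OF f] unfolding has_crown_def by blast
  show "has_crown (card I)" if "\<exists>b C. crown I b C"
    using that crown_transport[OF bij_betw_inv_into[OF f]] unfolding has_crown_def by blast
qed

section \<open>The betweenness principle\<close>

text \<open>
  Whether the arc from \<open>(\<beta>, v)\<close> to a vertex with index \<open>k\<close> ends in \<open>x\<^sub>k\<close> or \<open>y\<^sub>k\<close> depends only on \<open>\<beta>\<close> and on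
  \<open>T v k\<close>: for \<open>\<beta> = False\<close> it is read off from \<open>T v k\<close>, and for \<open>\<beta> = True\<close> from \<open>T k v\<close>, because the index
  \<open>k\<close> lies between the two ends. Reversing the arc exchanges \<open>T v k\<close> and \<open>T k v\<close>, and so it
  contradicts antisymmetry. The relation \<open>Q\<close> names the pairs of indices that are used.
\<close>

lemma betweenness_harmonious:
  assumes E: "\<And>i j. (i, j) \<in> E \<Longrightarrow>
      i \<noteq> j \<and> Q i (L i j) \<and> Q (L i j) j \<and> T i (L i j) = T (L i j) j"
    and Q: "\<And>i k. Q i k \<Longrightarrow> Q k i \<and> T k i \<noteq> T i k"
    and row: "\<And>i j j'. (i, j) \<in> E \<Longrightarrow> (i, j') \<in> E \<Longrightarrow> L i j = L i j' \<Longrightarrow> j = j'"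
    and col: "\<And>i i' j. (i, j) \<in> E \<Longrightarrow> (i', j) \<in> E \<Longrightarrow> L i j = L i' j \<Longrightarrow> i = i'"
  shows "harmonious_on b E (\<lambda>(i, j). (T i (L i j), L i j))" (is "harmonious_on b E ?C")
proof -
  have key: "Q (snd v) (snd (?C e)) \<and> fst (?C e) = (T (snd v) (snd (?C e)) \<noteq> fst v)"
    if "e \<in> E" "v \<in> cell_ends b e" for e v
  proof -
    obtain i j where e: "e = (i, j)" by fastforce
    show ?thesis
      using E[of i j] Q[of "L i j" j] that by (auto simp: e cell_ends_off)
  qed
  show ?thesis
  proof (rule harmonious_onI)
    fix e f v assume e: "e \<in> E" and f: "f \<in> E" and eq: "?C e = ?C f"
      and v: "v \<in> cell_ends b e" "v \<in> cell_ends b f"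
    obtain i j k l where ef: "e = (i, j)" "f = (k, l)" by fastforce
    have "i \<noteq> j" "k \<noteq> l" using E e f ef by blast+
    then show "e = f"
      using eq v e f row[of i j l] col[of i j k] by (auto simp: ef cell_ends_off)
  next
    fix e f assume e: "e \<in> E" and f: "f \<in> E"
      and *: "?C f \<in> cell_ends b e" "?C e \<in> cell_ends b f"
    show False
      using key[OF e *(1)] key[OF f *(2)] Q[of "snd (?C f)" "snd (?C e)"] by auto
  qed
qed

text \<open>
  Partial colourings that use disjoint sets of pairs of colours can be put together: the label \<open>\<rho>\<close> of
  an unordered pair of vertices tells which part the pair belongs to.
\<close>

lemma harmonious_on_by_classes:
  assumes H: "\<And>\<kappa>. harmonious_on b {e \<in> E. cls e = \<kappa>} C"
    and cls: "\<And>e v. e \<in> E \<Longrightarrow> v \<in> cell_ends b e \<Longrightarrow> \<rho> v (C e) = cls e"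
    and sym: "\<And>v w. \<rho> v w = \<rho> w v"
  shows "harmonious_on b E C"
proof (rule harmonious_onI)
  fix e f v assume e: "e \<in> E" and f: "f \<in> E" and eq: "C e = C f"
    and v: "v \<in> cell_ends b e" "v \<in> cell_ends b f"
  have "cls e = cls f" using cls[OF e v(1)] cls[OF f v(2)] eq by simp
  then show "e = f" using harmonious_onD(1)[OF H[of "cls f"] _ _ v eq] e f by simp
next
  fix e f assume e: "e \<in> E" and f: "f \<in> E"
    and *: "C f \<in> cell_ends b e" "C e \<in> cell_ends b f"
  have "cls e = cls f"
    using cls[OF e *(1)] cls[OF f *(2)] sym[of "C f" "C e"] by simp
  then show False using harmonious_onD(2)[OF H[of "cls f"] _ _ *] e f by simp
qed

lemma harmonious_on_cong:
  assumes "\<And>e. e \<in> E \<Longrightarrow> C e = C' e" and "\<And>i. (i, i) \<in> E \<Longrightarrow> b i = b' i"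
    and "harmonious_on b E C"
  shows "harmonious_on b' E C'"
proof -
  have "cell_ends b e = cell_ends b' e" if "e \<in> E" for e
    using assms(2) that by (cases e) (auto simp: cell_ends_def)
  with assms(1,3) show ?thesis unfolding harmonious_on_def by auto
qed


text \<open>
  Replace every index by \<open>w\<close> copies and combine \<open>L\<close> with addition modulo \<open>w\<close>. The betweenness
  principle colours all cells between different groups and uses only pairs of indices from different
  groups. What is left inside a group is a crown again.
\<close>

lemma crown_inflate:
  fixes J :: "'j set" and \<gamma> :: "'j \<Rightarrow> 'k" and L :: "'j \<Rightarrow> 'j \<Rightarrow> 'j" and T :: "'j \<Rightarrow> 'j \<Rightarrow> bool"
  assumes fin: "finite J"
    and between: "\<And>i j. i \<in> J \<Longrightarrow> j \<in> J \<Longrightarrow> \<gamma> i \<noteq> \<gamma> j \<Longrightarrow>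
      L i j \<in> J \<and> \<gamma> (L i j) \<noteq> \<gamma> i \<and> \<gamma> (L i j) \<noteq> \<gamma> j \<and> T i (L i j) = T (L i j) j"
    and antisym: "\<And>i k. i \<in> J \<Longrightarrow> k \<in> J \<Longrightarrow> \<gamma> i \<noteq> \<gamma> k \<Longrightarrow> T k i \<noteq> T i k"
    and row: "\<And>i j j'. i \<in> J \<Longrightarrow> j \<in> J \<Longrightarrow> j' \<in> J \<Longrightarrow> \<gamma> i \<noteq> \<gamma> j \<Longrightarrow> \<gamma> i \<noteq> \<gamma> j' \<Longrightarrow>
      L i j = L i j' \<Longrightarrow> j = j'"
    and col: "\<And>i i' j. i \<in> J \<Longrightarrow> i' \<in> J \<Longrightarrow> j \<in> J \<Longrightarrow> \<gamma> i \<noteq> \<gamma> j \<Longrightarrow> \<gamma> i' \<noteq> \<gamma> j \<Longrightarrow>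
      L i j = L i' j \<Longrightarrow> i = i'"
    and fill: "\<And>\<kappa>. \<kappa> \<in> \<gamma> ` J \<Longrightarrow> has_crown (card {j \<in> J. \<gamma> j = \<kappa>} * w)"
  shows "has_crown (card J * w)"
proof -
  define I where "I = J \<times> {..<w}"
  define g where "g = (\<lambda>i :: 'j \<times> nat. \<gamma> (fst i))"
  define grp where "grp = (\<lambda>\<kappa>. {i \<in> I. g i = \<kappa>})"
  have "\<exists>b C. crown (grp \<kappa>) b C" if "\<kappa> \<in> \<gamma> ` J" for \<kappa>
  proof -
    have "grp \<kappa> = {j \<in> J. \<gamma> j = \<kappa>} \<times> {..<w}"
      by (auto simp: grp_def I_def g_def)
    then show ?thesis
      using fill[OF that] fin has_crown_iff[of "grp \<kappa>"] by (simp add: card_cartesian_product)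
  qed
  then obtain bb CC where fills: "\<And>\<kappa>. \<kappa> \<in> \<gamma> ` J \<Longrightarrow> crown (grp \<kappa>) (bb \<kappa>) (CC \<kappa>)"
    by metis
  define b where "b = (\<lambda>i. bb (g i) i)"
  define M where "M = (\<lambda>(i :: 'j \<times> nat) (j :: 'j \<times> nat). (L (fst i) (fst j), (snd i + snd j) mod w))"
  define S where "S = (\<lambda>(i :: 'j \<times> nat) (k :: 'j \<times> nat). T (fst i) (fst k))"
  define far where "far = (\<lambda>(i, j). (S i (M i j), M i j))"
  define C where "C = (\<lambda>e. if g (fst e) = g (snd e) then CC (g (fst e)) e else far e)"
  define cls where "cls = (\<lambda>e. if g (fst e) = g (snd e) then Some (g (fst e)) else None)"
  define \<rho> where "\<rho> = (\<lambda>(v :: bool \<times> 'j \<times> nat) (w :: bool \<times> 'j \<times> nat). cls (snd v, snd w))"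
  have gI: "g i \<in> \<gamma> ` J" "i \<in> grp (g i)" if "i \<in> I" for i
    using that by (auto simp: I_def g_def grp_def)
  have far: "M i j \<in> I \<and> g (M i j) \<noteq> g i \<and> g (M i j) \<noteq> g j \<and> S i (M i j) = S (M i j) j"
    if "i \<in> I" "j \<in> I" "g i \<noteq> g j" for i j
    using that between[of "fst i" "fst j"] by (auto simp: I_def g_def M_def S_def)
  have near: "snd (CC (g (fst e)) e) \<in> I \<and> g (snd (CC (g (fst e)) e)) = g (fst e)"
    if "e \<in> I \<times> I" "g (fst e) = g (snd e)" for e
  proof -
    have "e \<in> grp (g (fst e)) \<times> grp (g (fst e))"
      using that by (cases e) (auto simp: grp_def)
    then have "snd (CC (g (fst e)) e) \<in> grp (g (fst e))"
      using fills[of "g (fst e)"] gI that unfolding crown_def by auto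
    then show ?thesis by (simp add: grp_def)
  qed
  have add_cancel: "u = v" if "(x + u) mod w = (x + v) mod w" "u < w" "v < w" for x u v :: nat
    using that by (metis cong_add_lcancel_nat cong_def mod_less)
  have "harmonious_on b (I \<times> I) C"
  proof (rule harmonious_on_by_classes[where cls = cls and \<rho> = \<rho>])
    fix \<kappa> :: "'k option"
    show "harmonious_on b {e \<in> I \<times> I. cls e = \<kappa>} C"
    proof (cases \<kappa>)
      case None
      have "harmonious_on b {(i, j). i \<in> I \<and> j \<in> I \<and> g i \<noteq> g j} far"
        unfolding far_def
      proof (rule betweenness_harmonious[where Q = "\<lambda>i k. i \<in> I \<and> k \<in> I \<and> g i \<noteq> g k"])
        fix i j assume "(i, j) \<in> {(i, j). i \<in> I \<and> j \<in> I \<and> g i \<noteq> g j}"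
        then show "i \<noteq> j \<and> (i \<in> I \<and> M i j \<in> I \<and> g i \<noteq> g (M i j)) \<and>
            (M i j \<in> I \<and> j \<in> I \<and> g (M i j) \<noteq> g j) \<and> S i (M i j) = S (M i j) j"
          using far[of i j] by auto
      next
        fix i k assume "i \<in> I \<and> k \<in> I \<and> g i \<noteq> g k"
        then show "(k \<in> I \<and> i \<in> I \<and> g k \<noteq> g i) \<and> S k i \<noteq> S i k"
          using antisym[of "fst i" "fst k"] by (auto simp: I_def g_def S_def)
      next
        fix i j j' assume "(i, j) \<in> {(i, j). i \<in> I \<and> j \<in> I \<and> g i \<noteq> g j}"
          "(i, j') \<in> {(i, j). i \<in> I \<and> j \<in> I \<and> g i \<noteq> g j}" "M i j = M i j'"
        then show "j = j'"
          using row[of "fst i" "fst j" "fst j'"] add_cancel[of "snd i" "snd j" "snd j'"]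
          by (auto simp: I_def g_def M_def)
      next
        fix i i' j assume "(i, j) \<in> {(i, j). i \<in> I \<and> j \<in> I \<and> g i \<noteq> g j}"
          "(i', j) \<in> {(i, j). i \<in> I \<and> j \<in> I \<and> g i \<noteq> g j}" "M i j = M i' j"
        then show "i = i'"
          using col[of "fst i" "fst i'" "fst j"] add_cancel[of "snd j" "snd i" "snd i'"]
          by (auto simp: I_def g_def M_def add.commute)
      qed
      moreover have "{e \<in> I \<times> I. cls e = \<kappa>} = {(i, j). i \<in> I \<and> j \<in> I \<and> g i \<noteq> g j}"
        using None by (auto simp: cls_def)
      ultimately show ?thesis
        by (auto intro: harmonious_on_cong[where C = far and b = b] simp: C_def)
    next
      case (Some \<kappa>')
      have eq: "{e \<in> I \<times> I. cls e = \<kappa>} = grp \<kappa>' \<times> grp \<kappa>'"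
        using Some by (auto simp: cls_def grp_def split: if_splits)
      show ?thesis
      proof (cases "\<kappa>' \<in> \<gamma> ` J")
        case True
        then have "harmonious_on (bb \<kappa>') (grp \<kappa>' \<times> grp \<kappa>') (CC \<kappa>')"
          using fills by (simp add: crown_def)
        then show ?thesis
          unfolding eq by (rule harmonious_on_cong[rotated 2]) (auto simp: C_def b_def grp_def)
      next
        case False
        then have "grp \<kappa>' = {}"
          using gI(1) by (auto simp: grp_def)
        then show ?thesis unfolding eq by (simp add: harmonious_on_def)
      qed
    qed
  next
    fix e v assume e: "e \<in> I \<times> I" and v: "v \<in> cell_ends b e"
    obtain i j where ij: "e = (i, j)" by (cases e)
    have "snd v = i \<or> snd v = j"
      using v snd_cell_ends unfolding ij by fast
    then show "\<rho> v (C e) = cls e"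
      using near[OF e] far[of i j] e by (auto simp: \<rho>_def cls_def C_def ij far_def)
  next
    show "\<rho> v w = \<rho> w v" for v w
      by (auto simp: \<rho>_def cls_def)
  qed
  moreover have "\<forall>e\<in>I \<times> I. snd (C e) \<in> I"
    using near far by (auto simp: C_def far_def)
  moreover have "inj_on (\<lambda>i. C (i, i)) I"
  proof (rule inj_onI)
    fix i j assume i: "i \<in> I" and j: "j \<in> I" and eq: "C (i, i) = C (j, j)"
    have "g i = g j"
      using near[of "(i, i)"] near[of "(j, j)"] i j eq by (simp add: C_def)
    moreover have "inj_on (\<lambda>i. CC (g i) (i, i)) (grp (g i))"
      using fills[OF gI(1)[OF i]] by (simp add: crown_def grp_def inj_on_def)
    ultimately show "i = j"
      using eq gI(2)[OF i] gI(2)[OF j] unfolding inj_on_def C_def by simp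
  qed
  ultimately have "crown I b C"
    by (simp add: crown_def)
  moreover have "finite I" "card I = card J * w"
    using fin by (simp_all add: I_def card_cartesian_product)
  ultimately show ?thesis
    using has_crown_iff by metis
qed

section \<open>Products with odd factors\<close>

text \<open>
  For odd \<open>N\<close> the parity of the least residue is a rotational tournament on \<open>\<int>\<^sub>N\<close>.
\<close>

lemma odd_mod_minus:
  fixes x N :: int
  assumes "odd N" "N > 0" "\<not> N dvd x"
  shows "odd ((- x) mod N) \<noteq> odd (x mod N)"
proof -
  have "(- x) mod N = N - x mod N"
    using assms(3) by (simp add: zmod_zminus1_eq_if dvd_eq_mod_eq_0)
  then show ?thesis using assms(1) by simp
qed

text \<open>
  The groups are the points of \<open>\<int>\<^sub>t\<close> and \<open>L\<close> is the midpoint. It lies between its ends in every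
  rotational tournament because both steps are equal.
\<close>

lemma has_crown_mult_odd:
  assumes t: "odd t" and g: "has_crown g"
  shows "has_crown (t * g)"
proof -
  define N where "N = int t"
  define h where "h = (N + 1) div 2"
  have N: "N > 0" "2 * h = N + 1"
    using t by (auto simp: N_def h_def elim!: oddE)
  have odd_N: "odd N" using t by (simp add: N_def)
  have cancel2: "x = y" if "[2 * x = 2 * y] (mod N)" "x \<in> {0..<N}" "y \<in> {0..<N}" for x y :: int
  proof -
    have "coprime 2 N" using odd_N by simp
    then have "[x = y] (mod N)" using that(1) cong_mult_lcancel by metis
    then show ?thesis using that by (simp add: cong_def)
  qed
  define L where "L = (\<lambda>i j :: int. ((i + j) * h) mod N)"
  define T where "T = (\<lambda>i k :: int. odd ((k - i) mod N))"
  have L: "[2 * L i j = i + j] (mod N)" for i j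
  proof -
    have "2 * ((i + j) * h) = (i + j) + (i + j) * N"
      using N(2) by (metis distrib_left mult.assoc mult.commute mult.right_neutral add.commute)
    moreover have "[2 * L i j = 2 * ((i + j) * h)] (mod N)"
      unfolding L_def by (simp add: cong_def mod_mult_right_eq)
    ultimately show ?thesis by (simp add: cong_def)
  qed
  have LJ: "L i j \<in> {0..<N}" for i j
    using N by (simp add: L_def)
  have "has_crown (card {0..<N} * g)"
  proof (rule crown_inflate[where \<gamma> = id and L = L and T = T])
    fix i j assume ij: "i \<in> {0..<N}" "j \<in> {0..<N}" "id i \<noteq> id j"
    have "L i j \<noteq> i"
    proof
      assume "L i j = i"
      then have "[i + i = i + j] (mod N)" using L[of i j] by (simp only: mult_2)
      then have "[i = j] (mod N)" by (simp only: cong_add_lcancel)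
      then show False using ij by (simp add: cong_def)
    qed
    moreover have "L i j \<noteq> j"
    proof
      assume "L i j = j"
      then have "[j + j = i + j] (mod N)" using L[of i j] by (simp only: mult_2)
      then have "[j = i] (mod N)" by (simp only: cong_add_rcancel)
      then show False using ij by (simp add: cong_def)
    qed
    moreover have "T i (L i j) = T (L i j) j"
    proof -
      have "[L i j + L i j - i - L i j = i + j - i - L i j] (mod N)"
        using L[of i j] by (intro cong_diff cong_refl) simp
      then have "(L i j - i) mod N = (j - L i j) mod N"
        by (simp add: cong_def)
      then show ?thesis by (simp add: T_def)
    qed
    ultimately show "L i j \<in> {0..<N} \<and> id (L i j) \<noteq> id i \<and> id (L i j) \<noteq> id j \<and> T i (L i j) = T (L i j) j"
      using LJ by simp
  next
    fix i k assume ik: "i \<in> {0..<N}" "k \<in> {0..<N}" "id i \<noteq> id k"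
    have "\<not> N dvd (k - i)"
      using ik by (metis atLeastLessThan_iff cong_iff_dvd_diff cong_less_imp_eq_int id_apply)
    then show "T k i \<noteq> T i k"
      using odd_mod_minus[OF odd_N N(1), of "k - i"] by (simp add: T_def)
  next
    fix i j j' assume "i \<in> {0..<N}" "j \<in> {0..<N}" "j' \<in> {0..<N}" "L i j = L i j'"
    then show "j = j'"
      using L[of i j] L[of i j']
      by (metis atLeastLessThan_iff cong_add_lcancel cong_less_imp_eq_int cong_sym cong_trans)
  next
    fix i i' j assume "i \<in> {0..<N}" "i' \<in> {0..<N}" "j \<in> {0..<N}" "L i j = L i' j"
    then show "i = i'"
      using L[of i j] L[of i' j]
      by (metis atLeastLessThan_iff cong_add_rcancel cong_less_imp_eq_int cong_sym cong_trans)
  next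
    fix \<kappa> assume "\<kappa> \<in> id ` {0..<N}"
    then have "{j \<in> {0..<N}. id j = \<kappa>} = {\<kappa>}" by auto
    then show "has_crown (card {j \<in> {0..<N}. id j = \<kappa>} * g)"
      using g by simp
  qed simp
  then show ?thesis by (simp add: N_def)
qed

text \<open>
  The only cell is the edge from \<open>\<infinity>\<close> to \<open>y\<^sub>0\<close>, with the colour \<open>x\<^sub>0\<close>.
\<close>

lemma has_crown_1: "has_crown 1"
proof -
  have "crown {0 :: nat} (\<lambda>i. True) (\<lambda>e. (False, 0))"
    by (auto simp: crown_def harmonious_on_def)
  then show ?thesis using has_crown_iff[of "{0 :: nat}"] by auto
qed

lemma has_crown_odd: "odd m \<Longrightarrow> has_crown m"
  using has_crown_mult_odd[OF _ has_crown_1] by simp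

section \<open>The affine plane of order three\<close>

definition f3_plane :: "(int \<times> int) list" where
  "f3_plane = [(0, 1), (0, 2), (1, 0), (1, 1), (1, 2), (2, 0), (2, 1), (2, 2)]"

text \<open>
  The third point of the line through \<open>p\<close> and \<open>q\<close> in the affine plane over the field with three elements.
\<close>

definition f3_third :: "int \<times> int \<Rightarrow> int \<times> int \<Rightarrow> int \<times> int" where
  "f3_third p q = ((- fst p - fst q) mod 3, (- snd p - snd q) mod 3)"

text \<open>
  The determinant of \<open>p\<close> and \<open>q\<close> is \<open>1\<close>. If \<open>p + k + q = 0\<close>, then \<open>p, k\<close> and \<open>k, q\<close> have the same
  determinant, and exchanging two points changes its sign; this makes \<open>k\<close> lie between \<open>p\<close> and \<open>q\<close>.
\<close>

definition f3_turn :: "int \<times> int \<Rightarrow> int \<times> int \<Rightarrow> bool" where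
  "f3_turn p q = ((fst p * snd q - snd p * fst q) mod 3 = 1)"

text \<open>
  A complete invariant of the pair \<open>{p, -p}\<close>: the quadratic monomials in the coordinates of \<open>p\<close>.
\<close>

definition f3_line :: "int \<times> int \<Rightarrow> int \<times> int \<times> int" where
  "f3_line p = (fst p * fst p mod 3, fst p * snd p mod 3, snd p * snd p mod 3)"

lemma f3_between:
  "list_all (\<lambda>p. list_all (\<lambda>q. f3_line p \<noteq> f3_line q \<longrightarrow>
     f3_third p q \<in> set f3_plane \<and> f3_line (f3_third p q) \<noteq> f3_line p \<and>
     f3_line (f3_third p q) \<noteq> f3_line q \<and>
     f3_turn p (f3_third p q) = f3_turn (f3_third p q) q \<and> f3_turn q p \<noteq> f3_turn p q) f3_plane) f3_plane"
  by code_simp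

lemma f3_cancel:
  "list_all (\<lambda>p. distinct (map (f3_third p) f3_plane) \<and> distinct (map (\<lambda>q. f3_third q p) f3_plane)) f3_plane"
  by code_simp

lemma f3_line_size:
  "list_all (\<lambda>p. length (filter (\<lambda>q. f3_line q = f3_line p) f3_plane) = 2) f3_plane"
  by code_simp

lemma f3_distinct: "distinct f3_plane"
  by code_simp

text \<open>
  The nonzero points of the plane, grouped as \<open>{p, -p}\<close>, give four groups of two. Powers of two cannot
  be reached with an odd number of groups, so this is the step that multiplies the order by \<open>4\<close>.
\<close>

lemma has_crown_mult_4:
  assumes "has_crown (2 * w)"
  shows "has_crown (8 * w)"
proof -
  have card: "card (set f3_plane) = 8"
    using distinct_card[OF f3_distinct] by (simp add: f3_plane_def)
  have "has_crown (card (set f3_plane) * w)"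
  proof (rule crown_inflate[where \<gamma> = f3_line and L = f3_third and T = f3_turn])
    fix p q assume "p \<in> set f3_plane" "q \<in> set f3_plane" "f3_line p \<noteq> f3_line q"
    then show "f3_third p q \<in> set f3_plane \<and> f3_line (f3_third p q) \<noteq> f3_line p \<and>
        f3_line (f3_third p q) \<noteq> f3_line q \<and> f3_turn p (f3_third p q) = f3_turn (f3_third p q) q"
      and "f3_turn q p \<noteq> f3_turn p q"
      using f3_between unfolding list_all_iff by blast+
  next
    fix p q q' assume "p \<in> set f3_plane" "q \<in> set f3_plane" "q' \<in> set f3_plane"
      "f3_third p q = f3_third p q'"
    then show "q = q'"
      using f3_cancel unfolding list_all_iff distinct_map inj_on_def by blast
  next
    fix q q' p assume "q \<in> set f3_plane" "q' \<in> set f3_plane" "p \<in> set f3_plane"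
      "f3_third q p = f3_third q' p"
    then show "q = q'"
      using f3_cancel unfolding list_all_iff distinct_map inj_on_def by blast
  next
    fix \<kappa> assume "\<kappa> \<in> f3_line ` set f3_plane"
    then obtain p where p: "p \<in> set f3_plane" "\<kappa> = f3_line p" by blast
    have "card {q \<in> set f3_plane. f3_line q = \<kappa>} = length (filter (\<lambda>q. f3_line q = f3_line p) f3_plane)"
      using distinct_card[of "filter (\<lambda>q. f3_line q = f3_line p) f3_plane"] f3_distinct p by simp
    also have "\<dots> = 2"
      using f3_line_size p unfolding list_all_iff by blast
    finally show "has_crown (card {q \<in> set f3_plane. f3_line q = \<kappa>} * w)"
      using assms by simp
  qed simp
  then show ?thesis by (simp add: card)
qed

section \<open>Colourings with a cyclic symmetry\<close>

text \<open>
  Indices are now pairs of a type and an element of \<open>\<int>\<^sub>N\<close>. The orbit \<open>((a, b, \<delta>), \<tau>, c, x)\<close> stands for the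
  \<open>N\<close> cells with row \<open>(a, i)\<close> and column \<open>(b, i + \<delta>)\<close>, where \<open>i\<close> runs through \<open>\<int>\<^sub>N\<close>, and colours them with
  \<open>(\<tau>, (c, i + x))\<close>.
\<close>

type_synonym 'g orbit = "('g \<times> 'g \<times> int) \<times> bool \<times> 'g \<times> int"

text \<open>
  An entry \<open>(q, u, p, w, d)\<close> records the arcs of the orbit \<open>q\<close> that leave one of its ends: they go from
  the vertex of type \<open>u\<close> at \<open>i + p\<close> to the vertex of type \<open>w\<close> at \<open>i + p + d\<close>.
\<close>

definition orbit_flags :: "('g \<Rightarrow> bool) \<Rightarrow> 'g orbit \<Rightarrow>
    ('g orbit \<times> (bool \<times> 'g) \<times> int \<times> (bool \<times> 'g) \<times> int) list" where
  "orbit_flags s q = (case q of ((a, b, \<delta>), \<tau>, c, x) \<Rightarrow>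
     if a = b \<and> \<delta> = 0 then [(q, (s a, a), 0, (\<tau>, c), x)]
     else [(q, (False, a), 0, (\<tau>, c), x), (q, (True, b), \<delta>, (\<tau>, c), x - \<delta>)])"

text \<open>
  Two families of arcs meet in an unordered pair of vertices. The predicate \<open>Z\<close> holds at least for
  the multiples of \<open>N\<close>; it allows one computation to serve for all large \<open>N\<close>.
\<close>

definition flags_clash :: "(int \<Rightarrow> bool) \<Rightarrow> 'q \<times> 'u \<times> int \<times> 'u \<times> int \<Rightarrow> 'q \<times> 'u \<times> int \<times> 'u \<times> int \<Rightarrow> bool" where
  "flags_clash Z = (\<lambda>(q, u, p, w, d) (q', u', p', w', d').
     (u = u' \<and> w = w' \<and> Z (d - d')) \<or> (u = w' \<and> w = u' \<and> Z (d + d')))"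

text \<open>
  An arc family from a type to itself must not contain its own reversal, whence the condition on
  \<open>2 * d\<close>. The last condition keeps the orbits with \<open>\<delta> \<noteq> 0\<close> off the diagonal.
\<close>

definition orbits_harmonious :: "(int \<Rightarrow> bool) \<Rightarrow> ('g \<Rightarrow> bool) \<Rightarrow> 'g orbit list \<Rightarrow> bool" where
  "orbits_harmonious Z s tab \<longleftrightarrow>
     (let F = concat (map (orbit_flags s) tab) in
       list_all (\<lambda>(q, u, p, w, d). u = w \<longrightarrow> \<not> Z (2 * d)) F \<and>
       sorted_wrt (\<lambda>x y. \<not> flags_clash Z x y) F) \<and>
     list_all (\<lambda>((a, b, \<delta>), _). a = b \<and> Z \<delta> \<longrightarrow> \<delta> = 0) tab"

lemma sorted_wrt_not_symD:
  assumes "sorted_wrt (\<lambda>x y. \<not> R x y) xs" "x \<in> set xs" "y \<in> set xs" "R x y" "R y x"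
  shows "x = y"
  using assms by (induction xs) auto

text \<open>
  By symmetry the clash of two arcs depends only on the orbits and on the differences modulo \<open>N\<close>, so
  a finite check on orbits suffices.
\<close>

lemma orbits_harmonious_on:
  fixes N :: int and s :: "'g \<Rightarrow> bool"
  assumes N: "N > 0" and Z: "\<And>n. N dvd n \<Longrightarrow> Z n \<and> Z (- n)"
    and tab: "orbits_harmonious Z s tab"
    and E: "\<And>e. e \<in> E \<Longrightarrow> \<exists>a b \<delta> \<tau> c x i. ((a, b, \<delta>), \<tau>, c, x) \<in> set tab \<and> i \<in> {0..<N} \<and>
      e = ((a, i), (b, (i + \<delta>) mod N)) \<and> C e = (\<tau>, (c, (i + x) mod N))"
  shows "harmonious_on (s \<circ> fst) E C"
proof -
  define F where "F = concat (map (orbit_flags s) tab)"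
  have self: "\<not> Z (2 * d)" if "(q, u, p, w, d) \<in> set F" "u = w" for q u p w d
  proof -
    have "list_all (\<lambda>(q, u, p, w, d). u = w \<longrightarrow> \<not> Z (2 * d)) F"
      using tab by (simp only: orbits_harmonious_def F_def Let_def)
    then have "\<forall>(q, u, p, w, d)\<in>set F. u = w \<longrightarrow> \<not> Z (2 * d)"
      by (simp add: list_all_iff)
    from bspec[OF this that(1)] show ?thesis
      using that(2) by simp
  qed
  have uniq: "x = y" if "x \<in> set F" "y \<in> set F" "flags_clash Z x y" "flags_clash Z y x" for x y
  proof -
    have "sorted_wrt (\<lambda>x y. \<not> flags_clash Z x y) F"
      using tab by (simp only: orbits_harmonious_def F_def Let_def)
    then show ?thesis
      using that by (rule sorted_wrt_not_symD)
  qed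
  have diag: "\<delta> = 0" if "((a, a, \<delta>), r) \<in> set tab" "N dvd \<delta>" for a \<delta> r
  proof -
    have "list_all (\<lambda>((a, b, \<delta>), _). a = b \<and> Z \<delta> \<longrightarrow> \<delta> = 0) tab"
      using tab by (simp only: orbits_harmonious_def Let_def)
    then have "\<forall>((a, b, \<delta>), _)\<in>set tab. a = b \<and> Z \<delta> \<longrightarrow> \<delta> = 0"
      by (simp add: list_all_iff)
    from bspec[OF this that(1)] show ?thesis
      using that(2) Z[of \<delta>] by simp
  qed
  \<comment> \<open>The arcs of the family \<open>y\<close> at position \<open>i\<close> start at the end \<open>v\<close> of the cell \<open>e\<close>.\<close>
  define occ where "occ = (\<lambda>(y :: 'g orbit \<times> (bool \<times> 'g) \<times> int \<times> (bool \<times> 'g) \<times> int) i e v. case y of (((a, b, \<delta>), t), u, p, w, d) \<Rightarrow>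
      i \<in> {0..<N} \<and> e = ((a, i), (b, (i + \<delta>) mod N)) \<and> v = (fst u, (snd u, (i + p) mod N)) \<and>
      C e = (fst w, (snd w, (i + p + d) mod N)))"
  have flag: "\<exists>y i. y \<in> set F \<and> occ y i e v"
    if ev: "e \<in> E" "v \<in> cell_ends (s \<circ> fst) e" for e v
  proof -
    obtain a b \<delta> \<tau> c x i where q: "((a, b, \<delta>), \<tau>, c, x) \<in> set tab" and i: "i \<in> {0..<N}"
      and e: "e = ((a, i), (b, (i + \<delta>) mod N))" and Ce: "C e = (\<tau>, (c, (i + x) mod N))"
      using E[OF ev(1)] by blast
    have F: "y \<in> set F" if "y \<in> set (orbit_flags s ((a, b, \<delta>), \<tau>, c, x))" for y
      using that q unfolding F_def by auto
    have i_mod: "i mod N = i" using i by simp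
    show ?thesis
    proof (cases "a = b \<and> \<delta> = 0")
      case True
      then have "(((a, b, \<delta>), \<tau>, c, x), (s a, a), 0, (\<tau>, c), x) \<in> set F"
        by (intro F) (simp add: orbit_flags_def)
      moreover have "v = (s a, (a, i))"
        using True ev(2) i_mod by (simp add: e)
      ultimately show ?thesis
        using i e Ce i_mod
        by (intro exI[of _ "(((a, b, \<delta>), \<tau>, c, x), (s a, a), 0, (\<tau>, c), x)"] exI[of _ i])
          (simp add: occ_def)
    next
      case False
      have "(a, i) \<noteq> (b, (i + \<delta>) mod N)"
      proof
        assume eq: "(a, i) = (b, (i + \<delta>) mod N)"
        then have "(i + \<delta>) mod N = i mod N" using i_mod by simp
        then have "N dvd \<delta>" by (simp add: mod_eq_dvd_iff)
        then show False using diag[of a \<delta>] q eq False by auto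
      qed
      then have v: "v = (False, (a, i)) \<or> v = (True, (b, (i + \<delta>) mod N))"
        using ev(2) by (auto simp: e cell_ends_off)
      have F': "(((a, b, \<delta>), \<tau>, c, x), (False, a), 0, (\<tau>, c), x) \<in> set F"
        "(((a, b, \<delta>), \<tau>, c, x), (True, b), \<delta>, (\<tau>, c), x - \<delta>) \<in> set F"
        using False by (auto intro!: F simp: orbit_flags_def)
      from v show ?thesis
      proof
        assume "v = (False, (a, i))"
        then show ?thesis
          using F'(1) i e Ce i_mod
          by (intro exI[of _ "(((a, b, \<delta>), \<tau>, c, x), (False, a), 0, (\<tau>, c), x)"] exI[of _ i])
            (simp add: occ_def)
      next
        assume "v = (True, (b, (i + \<delta>) mod N))"
        then show ?thesis
          using F'(2) i e Ce
          by (intro exI[of _ "(((a, b, \<delta>), \<tau>, c, x), (True, b), \<delta>, (\<tau>, c), x - \<delta>)"] exI[of _ i])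
            (simp add: occ_def)
      qed
    qed
  qed
  show ?thesis
  proof (rule harmonious_onI)
    fix e f v assume e: "e \<in> E" and f: "f \<in> E" and eq: "C e = C f"
      and v: "v \<in> cell_ends (s \<circ> fst) e" "v \<in> cell_ends (s \<circ> fst) f"
    obtain X i where X: "X \<in> set F" "occ X i e v"
      using flag[OF e v(1)] by blast
    obtain Y i' where Y: "Y \<in> set F" "occ Y i' f v"
      using flag[OF f v(2)] by blast
    obtain a b \<delta> t u p w d where X_eq: "X = (((a, b, \<delta>), t), u, p, w, d)"
      by (cases X) auto
    obtain a' b' \<delta>' t' u' p' w' d' where Y_eq: "Y = (((a', b', \<delta>'), t'), u', p', w', d')"
      by (cases Y) auto
    have x: "i \<in> {0..<N}" "e = ((a, i), (b, (i + \<delta>) mod N))" "v = (fst u, (snd u, (i + p) mod N))"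
      "C e = (fst w, (snd w, (i + p + d) mod N))"
      using X(2) unfolding occ_def X_eq prod.case by blast+
    have y: "i' \<in> {0..<N}" "f = ((a', i'), (b', (i' + \<delta>') mod N))"
      "v = (fst u', (snd u', (i' + p') mod N))" "C f = (fst w', (snd w', (i' + p' + d') mod N))"
      using Y(2) unfolding occ_def Y_eq prod.case by blast+
    have uw: "u = u'" "w = w'" and P: "N dvd (i + p) - (i' + p')"
      and D: "N dvd (i + p + d) - (i' + p' + d')"
      using trans[OF x(3)[symmetric] y(3)] trans[OF x(4)[symmetric] trans[OF eq y(4)]]
      by (simp_all add: prod_eq_iff mod_eq_dvd_iff)
    have "N dvd d - d'"
      using dvd_diff[OF D P] by (simp add: algebra_simps)
    then have "flags_clash Z X Y" "flags_clash Z Y X"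
      using Z[of "d - d'"] uw by (simp_all add: flags_clash_def X_eq Y_eq)
    then have same: "a = a'" "b = b'" "\<delta> = \<delta>'" "p = p'"
      using uniq[OF X(1) Y(1)] by (simp_all add: X_eq Y_eq)
    then have "N dvd i - i'" using P by simp
    then have "i mod N = i' mod N" by (simp add: mod_eq_dvd_iff)
    then have "i = i'" using x(1) y(1) by simp
    then show "e = f" using x(2) y(2) same by simp
  next
    fix e f assume e: "e \<in> E" and f: "f \<in> E"
      and v: "C f \<in> cell_ends (s \<circ> fst) e" "C e \<in> cell_ends (s \<circ> fst) f"
    obtain X i where X: "X \<in> set F" "occ X i e (C f)"
      using flag[OF e v(1)] by blast
    obtain Y i' where Y: "Y \<in> set F" "occ Y i' f (C e)"
      using flag[OF f v(2)] by blast
    obtain a b \<delta> t u p w d where X_eq: "X = (((a, b, \<delta>), t), u, p, w, d)"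
      by (cases X) auto
    obtain a' b' \<delta>' t' u' p' w' d' where Y_eq: "Y = (((a', b', \<delta>'), t'), u', p', w', d')"
      by (cases Y) auto
    have x: "C f = (fst u, (snd u, (i + p) mod N))" "C e = (fst w, (snd w, (i + p + d) mod N))"
      using X(2) unfolding occ_def X_eq prod.case by blast+
    have y: "C e = (fst u', (snd u', (i' + p') mod N))" "C f = (fst w', (snd w', (i' + p' + d') mod N))"
      using Y(2) unfolding occ_def Y_eq prod.case by blast+
    have uw: "u = w'" "w = u'" and P: "N dvd (i + p) - (i' + p' + d')"
      and D: "N dvd (i + p + d) - (i' + p')"
      using trans[OF x(1)[symmetric] y(2)] trans[OF x(2)[symmetric] y(1)]
      by (simp_all add: prod_eq_iff mod_eq_dvd_iff)
    have "N dvd d + d'"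
      using dvd_diff[OF D P] by (simp add: algebra_simps)
    then have dd: "Z (d + d')" using Z by blast
    then have "flags_clash Z X Y" "flags_clash Z Y X"
      using uw by (simp_all add: flags_clash_def X_eq Y_eq add.commute)
    then have "u = u'" "d = d'"
      using uniq[OF X(1) Y(1)] by (simp_all add: X_eq Y_eq)
    then show False
      using self[OF X(1)[unfolded X_eq]] uw dd by simp
  qed
qed

lemma has_crown_by_table:
  fixes F :: "nat \<Rightarrow> nat \<Rightarrow> int \<Rightarrow> bool \<times> nat \<times> int"
  assumes N: "N > 0" and Z: "\<And>n. N dvd n \<Longrightarrow> Z n \<and> Z (- n)"
    and tab: "orbits_harmonious Z s
      [((a, b, \<delta>), F a b \<delta>). a \<leftarrow> [0..<g], b \<leftarrow> [0..<g], \<delta> \<leftarrow> [0..N - 1]]"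
    and range: "list_all (\<lambda>a. list_all (\<lambda>b. list_all (\<lambda>\<delta>. fst (snd (F a b \<delta>)) < g) [0..N - 1]) [0..<g]) [0..<g]"
    and diag: "distinct (map (\<lambda>a. (fst (F a a 0), fst (snd (F a a 0)))) [0..<g])"
  shows "has_crown (g * nat N)"
proof -
  define I where "I = {0..<g} \<times> {0..<N}"
  define C where "C = (\<lambda>e. case F (fst (fst e)) (fst (snd e)) ((snd (snd e) - snd (fst e)) mod N) of
    (\<tau>, c, x) \<Rightarrow> (\<tau>, (c, (snd (fst e) + x) mod N)))"
  have d: "(j - i) mod N \<in> {0..N - 1}" for i j
    using N by simp
  let ?tab = "[((a, b, \<delta>), F a b \<delta>). a \<leftarrow> [0..<g], b \<leftarrow> [0..<g], \<delta> \<leftarrow> [0..N - 1]]"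
  have orbit: "((a, b, \<delta>), F a b \<delta>) \<in> set ?tab" if "a < g" "b < g" "\<delta> \<in> {0..N - 1}" for a b \<delta>
    using that
    by simp (rule bexI[of _ a], rule bexI[of _ b], rule image_eqI[of _ _ \<delta>], simp_all)
  have "harmonious_on (s \<circ> fst) (I \<times> I) C"
  proof (rule orbits_harmonious_on[OF N Z tab])
    fix e assume e: "e \<in> I \<times> I"
    obtain a i b j where ij: "e = ((a, i), (b, j))" by (cases e) auto
    obtain \<tau> c x where F: "F a b ((j - i) mod N) = (\<tau>, c, x)" by (cases "F a b ((j - i) mod N)")
    have "((a, b, (j - i) mod N), F a b ((j - i) mod N)) \<in> set ?tab"
      by (rule orbit) (use e d[of j i] in \<open>simp_all add: ij I_def\<close>)
    then have "((a, b, (j - i) mod N), \<tau>, c, x) \<in> set ?tab"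
      by (simp only: F)
    moreover have "(i + (j - i) mod N) mod N = j"
      using e by (simp add: ij I_def mod_add_right_eq)
    ultimately show "\<exists>a b \<delta> \<tau> c x i. ((a, b, \<delta>), \<tau>, c, x) \<in> set ?tab \<and>
        i \<in> {0..<N} \<and> e = ((a, i), (b, (i + \<delta>) mod N)) \<and> C e = (\<tau>, (c, (i + x) mod N))"
      using e F
      by (rule_tac x = a in exI, rule_tac x = b in exI, rule_tac x = "(j - i) mod N" in exI,
          rule_tac x = \<tau> in exI, rule_tac x = c in exI, rule_tac x = x in exI, rule_tac x = i in exI)
        (simp add: ij I_def C_def)
  qed
  moreover have "\<forall>e\<in>I \<times> I. snd (C e) \<in> I"
  proof
    fix e assume e: "e \<in> I \<times> I"
    obtain a i b j where ij: "e = ((a, i), (b, j))" by (cases e) auto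
    have "fst (snd (F a b ((j - i) mod N))) < g"
      using range d[of j i] e unfolding list_all_iff by (auto simp: ij I_def)
    then show "snd (C e) \<in> I"
      using N by (auto simp: C_def ij I_def split: prod.split)
  qed
  moreover have "inj_on (\<lambda>i. C (i, i)) I"
  proof (rule inj_onI)
    fix v w assume v: "v \<in> I" and w: "w \<in> I" and eq: "C (v, v) = C (w, w)"
    obtain a i b j where vw: "v = (a, i)" "w = (b, j)" by (cases v, cases w)
    obtain \<tau> c x \<tau>' c' x' where F: "F a a 0 = (\<tau>, c, x)" "F b b 0 = (\<tau>', c', x')"
      by (cases "F a a 0", cases "F b b 0")
    have *: "\<tau> = \<tau>'" "c = c'" "(i + x) mod N = (j + x') mod N"
      using eq F by (auto simp: C_def vw)
    have "inj_on (\<lambda>a. (fst (F a a 0), fst (snd (F a a 0)))) {0..<g}"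
      using diag by (simp add: distinct_map)
    then have "a = b"
      by (rule inj_onD) (use F * v w in \<open>simp_all add: vw I_def\<close>)
    then have "N dvd i - j"
      using * F by (simp add: mod_eq_dvd_iff)
    then have "i mod N = j mod N"
      by (simp add: mod_eq_dvd_iff)
    then show "v = w" using v w \<open>a = b\<close> by (simp add: vw I_def)
  qed
  ultimately have "crown I (s \<circ> fst) C"
    by (simp add: crown_def)
  moreover have "finite I" "card I = g * nat N"
    by (simp_all add: I_def card_cartesian_product)
  ultimately show ?thesis
    using has_crown_iff by metis
qed

section \<open>Crowns of order four, six and eight\<close>

text \<open>
  In the tables for the orders four and eight, row \<open>i\<close> and column \<open>j\<close> hold the colour of the cell
  \<open>(i, j)\<close>. The diagonal belongs to \<open>x\<^sub>i\<close> in the first half and to \<open>y\<^sub>i\<close> in the second half.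
\<close>

definition crown4_table :: "(bool \<times> nat) list list" where
  "crown4_table = (let x = Pair False; y = Pair True in
    [[y 2, x 3, y 1, x 2],
     [x 0, y 3, x 3, y 1],
     [x 1, y 0, x 1, y 2],
     [y 3, x 2, y 0, x 0]])"

definition crown8_table :: "(bool \<times> nat) list list" where
  "crown8_table = (let x = Pair False; y = Pair True in
    [[y 4, y 3, y 6, x 7, y 5, x 6, x 5, x 4],
     [y 7, y 5, x 0, x 6, y 0, x 5, y 1, x 7],
     [x 5, x 0, y 6, x 4, y 2, y 0, x 1, y 3],
     [x 0, x 2, x 1, y 7, x 6, y 1, y 3, y 4],
     [x 7, y 0, x 3, x 1, x 1, y 2, y 5, y 6],
     [x 3, y 7, y 3, y 4, x 4, x 2, x 6, y 2],
     [y 2, x 4, x 7, y 0, y 1, y 7, x 3, x 2],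
     [y 6, x 5, y 1, y 5, x 2, x 3, y 4, x 0]])"

text \<open>
  The order six comes from two types over \<open>\<int>\<^sub>3\<close>; the entry for \<open>a\<close>, \<open>b\<close>, \<open>\<delta>\<close> is the colour of the orbit of
  \<open>((a, 0), (b, \<delta>))\<close>.
\<close>

definition crown6_table :: "(bool \<times> nat \<times> int) list list list" where
  "crown6_table =
    [[[(True, 1, 0), (True, 0, 0), (False, 0, 1)], [(False, 1, 1), (True, 1, 2), (False, 1, 2)]],
     [[(True, 1, 1), (False, 1, 2), (False, 0, 0)], [(False, 0, 2), (True, 0, 1), (True, 0, 0)]]]"

lemma has_crown_4: "has_crown 4"
proof -
  have "has_crown (4 * nat 1)"
  proof (rule has_crown_by_table[where Z = "\<lambda>_. True" and s = "\<lambda>a. 2 \<le> a"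
        and F = "\<lambda>a b _. (fst (crown4_table ! a ! b), snd (crown4_table ! a ! b), 0)"])
    show "orbits_harmonious (\<lambda>_. True) (\<lambda>a. 2 \<le> a)
      [((a, b, \<delta>), fst (crown4_table ! a ! b), snd (crown4_table ! a ! b), 0).
        a \<leftarrow> [0..<4], b \<leftarrow> [0..<4], \<delta> \<leftarrow> [0..(1::int) - 1]]"
      by code_simp
  qed (code_simp | simp)+
  then show ?thesis by simp
qed

lemma has_crown_6: "has_crown 6"
proof -
  have "has_crown (2 * nat 3)"
  proof (rule has_crown_by_table[where Z = "\<lambda>n. n mod 3 = 0" and s = "\<lambda>a. 1 \<le> a"
        and F = "\<lambda>a b \<delta>. crown6_table ! a ! b ! nat \<delta>"])
    show "3 dvd n \<Longrightarrow> n mod 3 = 0 \<and> - n mod 3 = 0" for n :: int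
      by simp
  qed (code_simp | simp)+
  then show ?thesis by simp
qed

lemma has_crown_8: "has_crown 8"
proof -
  have "has_crown (8 * nat 1)"
  proof (rule has_crown_by_table[where Z = "\<lambda>_. True" and s = "\<lambda>a. 4 \<le> a"
        and F = "\<lambda>a b _. (fst (crown8_table ! a ! b), snd (crown8_table ! a ! b), 0)"])
  qed (code_simp | simp)+
  then show ?thesis by simp
qed

section \<open>Crowns of twice an odd order\<close>

text \<open>
  The indices are \<open>(False, i)\<close> and \<open>(True, i)\<close> with \<open>i\<close> in \<open>\<int>\<^sub>r\<close>. Cells of two equal types get the midpoint
  of type \<open>False\<close>, and a cell of two different types gets the reflection of its \<open>True\<close> end in its
  \<open>False\<close> end, with type \<open>True\<close>. This satisfies the betweenness principle, except for the cells of two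
  different types at the same position, whose reflection is one of their ends. To repair this, the
  cells with small offset are coloured by hand: \<open>near_table\<close> treats the cells whose
  offset is \<open>\<epsilon>\<close> (different types) or \<open>2\<epsilon>\<close> (equal types), where \<open>\<bar>\<epsilon>\<bar>\<close> is at most the width, and it only uses
  pairs of indices that the far cells leave free, namely those whose difference is \<open>2\<epsilon>\<close> (two indices
  of type \<open>True\<close>) or \<open>\<epsilon>\<close> (all others). The offsets are the same for all odd \<open>r \<ge> 5\<close>, so that one table
  is enough.
\<close>

definition width :: "bool \<Rightarrow> bool \<Rightarrow> int" where
  "width a b = (if a \<or> b then 2 else 1)"

definition pair_step :: "bool \<Rightarrow> bool \<Rightarrow> int" where
  "pair_step a b = (if a \<and> b then 2 else 1)"

definition cell_step :: "bool \<Rightarrow> bool \<Rightarrow> int" where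
  "cell_step a b = (if a = b then 2 else 1)"

text \<open>
  The list for \<open>a\<close> and \<open>b\<close> runs through \<open>\<epsilon> = - width a b, \<dots>, width a b\<close>. An entry \<open>(\<tau>, c, x)\<close> is the colour
  \<open>(\<tau>, (c, i + x))\<close> of the cell whose row is \<open>(a, i)\<close>. The middle entries for \<open>a = b\<close> are diagonal cells;
  they belong to \<open>x\<close> for the type \<open>False\<close> and to \<open>y\<close> for the type \<open>True\<close>.
\<close>

definition near_table :: "bool \<Rightarrow> bool \<Rightarrow> (bool \<times> bool \<times> int) list" where
  "near_table a b =
    (if \<not> a \<and> \<not> b then [(True, True, -1), (True, True, 0), (False, True, 1)]
     else if \<not> a then [(False, True, 2), (True, False, 1), (False, False, -1), (True, False, -1), (False, True, -2)]
     else if \<not> b then [(True, True, -2), (True, False, 0), (False, True, -2), (False, False, 1), (False, True, 4)]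
     else [(True, True, 0), (True, False, -1), (False, False, 2), (False, False, 0), (True, True, 2)])"

definition near_colour :: "bool \<Rightarrow> bool \<Rightarrow> int \<Rightarrow> bool \<times> bool \<times> int" where
  "near_colour a b \<epsilon> = near_table a b ! nat (\<epsilon> + width a b)"

definition near_orbits :: "bool orbit list" where
  "near_orbits = [((a, b, cell_step a b * \<epsilon>), near_colour a b \<epsilon>).
     a \<leftarrow> [False, True], b \<leftarrow> [False, True], \<epsilon> \<leftarrow> [- width a b..width a b]]"

text \<open>
  A decidable condition that rules out every odd divisor of size at least \<open>5\<close>. It is tuned to the
  differences in the table: differences of two indices of type \<open>True\<close> are even.
\<close>

definition indivisible :: "int \<Rightarrow> bool" where
  "indivisible n \<longleftrightarrow> n \<noteq> 0 \<and> (\<bar>n\<bar> < 5 \<or> even n \<and> \<bar>n\<bar> \<le> 8)"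

lemma near_orbits_harmonious: "orbits_harmonious (\<lambda>n. \<not> indivisible n) id near_orbits"
  by code_simp

definition multiple_le :: "int \<Rightarrow> int \<Rightarrow> int \<Rightarrow> bool" where
  "multiple_le c w n \<longleftrightarrow> c dvd n \<and> \<bar>n\<bar> \<le> c * w"

text \<open>
  The near cells stay within the pairs of indices that the far cells leave free.
\<close>

lemma near_orbits_near:
  "list_all (\<lambda>((a, b, \<delta>), \<tau>, c, x).
     multiple_le (pair_step a c) (width a c) x \<and> multiple_le (pair_step b c) (width b c) (x - \<delta>)) near_orbits"
  by code_simp

lemma near_orbitsI:
  assumes "\<bar>\<epsilon>\<bar> \<le> width a b"
  shows "((a, b, cell_step a b * \<epsilon>), near_colour a b \<epsilon>) \<in> set near_orbits"
  using assms unfolding near_orbits_def by (cases a; cases b; simp add: image_iff; intro bexI[of _ \<epsilon>]; auto)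

lemma dvd_not_indivisible:
  assumes "odd N" "N \<ge> 5" "N dvd n"
  shows "\<not> indivisible n"
proof
  assume "indivisible n"
  then have n: "n \<noteq> 0" "\<bar>n\<bar> < 5 \<or> even n \<and> \<bar>n\<bar> \<le> 8"
    by (auto simp: indivisible_def)
  from n(2) show False
  proof
    assume "\<bar>n\<bar> < 5"
    then show False using dvd_imp_le_int[OF n(1) assms(3)] assms(2) by simp
  next
    assume "even n \<and> \<bar>n\<bar> \<le> 8"
    then obtain m where m: "n = 2 * m" "\<bar>m\<bar> \<le> 4" by (auto elim!: evenE)
    have "N dvd m"
      using assms(1,3) m by (simp add: coprime_dvd_mult_right_iff)
    then show False
      using dvd_imp_le_int[of m N] n(1) m assms(2) by simp
  qed
qed

text \<open>
  The sign of the tournament \<open>T\<close> is reversed between different types, and halved differences are used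
  between two indices of type \<open>True\<close>; with these two changes midpoints and reflections lie between
  the ends of their cells.
\<close>

lemma has_crown_double_odd:
  assumes r: "odd r" "r \<ge> 5"
  shows "has_crown (2 * r)"
proof -
  define N where "N = int r"
  define h where "h = (N + 1) div 2"
  have N: "N > 0" "N \<ge> 5" "odd N" and h: "2 * h = N + 1"
    using r by (auto simp: N_def h_def elim!: oddE)
  define I where "I = (UNIV :: bool set) \<times> {0..<N}"
  define s where "s = (\<lambda>x. odd (x mod N))"
  define nearP where "nearP = (\<lambda>u v :: bool \<times> int. \<exists>\<epsilon>. \<bar>\<epsilon>\<bar> \<le> width (fst u) (fst v) \<and>
    N dvd (snd v - snd u) - pair_step (fst u) (fst v) * \<epsilon>)"
  define offset where "offset = (\<lambda>(u :: bool \<times> int) (v :: bool \<times> int) \<epsilon>. \<bar>\<epsilon>\<bar> \<le> width (fst u) (fst v) \<and>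
    N dvd (snd v - snd u) - cell_step (fst u) (fst v) * \<epsilon>)"
  define nearC where "nearC = (\<lambda>u v. \<exists>\<epsilon>. offset u v \<epsilon>)"
  define L where "L = (\<lambda>u v. if fst u = fst v then (False, ((snd u + snd v) * h) mod N)
    else (True, (if fst u then 2 * snd v - snd u else 2 * snd u - snd v) mod N))"
  define T where "T = (\<lambda>u v. if fst u \<and> fst v then s ((snd v - snd u) * h)
    else if fst u \<or> fst v then \<not> s (snd v - snd u) else s (snd v - snd u))"
  define far where "far = (\<lambda>(u, v). (T u (L u v), L u v))"
  define near where "near = (\<lambda>(u, v). case near_colour (fst u) (fst v) (SOME \<epsilon>. offset u v \<epsilon>) of
    (\<tau>, c, x) \<Rightarrow> (\<tau>, (c, (snd u + x) mod N)))"
  define cls where "cls = (\<lambda>(u, v). nearC u v)"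
  define C where "C = (\<lambda>e. if cls e then near e else far e)"
  define \<rho> where "\<rho> = (\<lambda>(v :: bool \<times> bool \<times> int) (w :: bool \<times> bool \<times> int). nearP (snd v) (snd w))"

  have s_cong: "s x = s y" if "N dvd x - y" for x y
    using that by (simp add: s_def mod_eq_dvd_iff[symmetric])
  have s_minus: "s (- x) \<noteq> s x" if "\<not> N dvd x" for x
    using odd_mod_minus[OF N(3,1) that] by (simp add: s_def)
  have dvd2: "N dvd x" if "N dvd 2 * x" for x
    using that N(3) by (simp add: coprime_dvd_mult_right_iff)
  have mod_dvd: "N dvd x mod N - x" for x
    by (metis mod_eq_dvd_iff mod_mod_trivial)
  have half: "N dvd 2 * (x * h) - x" for x
  proof -
    have "2 * (x * h) - x = x * (2 * h) - x" by simp
    also have "\<dots> = x * N" by (simp only: h) (simp add: algebra_simps)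
    finally show ?thesis by simp
  qed
  have L_same: "fst (L u v) = False \<and> N dvd 2 * snd (L u v) - (snd u + snd v)" if "fst u = fst v" for u v
  proof -
    have "N dvd 2 * (((snd u + snd v) * h) mod N - (snd u + snd v) * h) + (2 * ((snd u + snd v) * h) - (snd u + snd v))"
      by (rule dvd_add[OF dvd_mult[OF mod_dvd] half])
    then show ?thesis using that by (simp add: L_def algebra_simps)
  qed
  have L_ft: "fst (L u v) = True \<and> N dvd snd (L u v) - (2 * snd u - snd v)" if "\<not> fst u" "fst v" for u v
    using that mod_dvd by (simp add: L_def)
  have L_tf: "fst (L u v) = True \<and> N dvd snd (L u v) - (2 * snd v - snd u)" if "fst u" "\<not> fst v" for u v
    using that mod_dvd by (simp add: L_def)
  have nearP_sym: "nearP u v \<longleftrightarrow> nearP v u" for u v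
  proof -
    have "nearP v u" if "nearP u v" for u v
    proof -
      obtain \<epsilon> where \<epsilon>: "\<bar>\<epsilon>\<bar> \<le> width (fst u) (fst v)" "N dvd (snd v - snd u) - pair_step (fst u) (fst v) * \<epsilon>"
        using \<open>nearP u v\<close> by (auto simp: nearP_def)
      have "(snd u - snd v) - pair_step (fst v) (fst u) * (- \<epsilon>) = - ((snd v - snd u) - pair_step (fst u) (fst v) * \<epsilon>)"
        by (auto simp: pair_step_def)
      then have "N dvd (snd u - snd v) - pair_step (fst v) (fst u) * (- \<epsilon>)"
        using \<epsilon>(2) by (simp only: dvd_minus_iff)
      moreover have "\<bar>- \<epsilon>\<bar> \<le> width (fst v) (fst u)"
        using \<epsilon>(1) by (auto simp: width_def)
      ultimately show ?thesis unfolding nearP_def by blast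
    qed
    then show ?thesis by blast
  qed
  have not_nearP: "\<not> N dvd snd v - snd u" if "\<not> nearP u v" for u v
    using that by (auto simp: nearP_def width_def dest!: spec[of _ 0] split: if_splits)
  have not_nearC: "\<not> N dvd snd v - snd u" if "\<not> nearC u v" for u v
    using that by (auto simp: nearC_def offset_def width_def dest!: spec[of _ 0] split: if_splits)
  have antisym: "\<not> nearP v u \<and> T v u \<noteq> T u v" if "\<not> nearP u v" for u v
  proof -
    let ?x = "snd v - snd u"
    have x: "\<not> N dvd ?x" using not_nearP[OF that] .
    have "\<not> N dvd ?x * h"
    proof
      assume "N dvd ?x * h"
      then have "N dvd 2 * (?x * h) - (2 * (?x * h) - ?x)"
        by (rule dvd_diff[OF dvd_mult half])
      then show False using x by simp
    qed
    then have "s ((snd u - snd v) * h) = (\<not> s (?x * h))"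
      using s_minus[of "?x * h"] by (simp add: algebra_simps)
    moreover have "s (snd u - snd v) = (\<not> s ?x)"
      using s_minus[OF x] by simp
    ultimately have "T v u \<noteq> T u v"
      by (simp add: T_def)
    then show ?thesis
      using that nearP_sym[of v u] by simp
  qed
  have far_near: "\<not> nearP u (L u v) \<and> \<not> nearP (L u v) v \<and> T u (L u v) = T (L u v) v"
    if "\<not> nearC u v" for u v
  proof -
    have no: "\<not> offset u v \<epsilon>" for \<epsilon>
      using that by (simp add: nearC_def)
    have ndvd: "\<not> N dvd snd v - snd u"
      using not_nearC[OF that] .
    define k where "k = snd (L u v)"
    consider "fst u = fst v" | "\<not> fst u" "fst v" | "fst u" "\<not> fst v" by blast
    then show ?thesis
    proof cases
      case 1
      have k: "fst (L u v) = False" "N dvd 2 * k - (snd u + snd v)"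
        using L_same[OF 1] by (simp_all add: k_def)
      have "offset u v \<epsilon>" if "N dvd (k - snd u) - \<epsilon>" "\<bar>\<epsilon>\<bar> \<le> width (fst u) False" for \<epsilon>
      proof -
        have "N dvd 2 * ((k - snd u) - \<epsilon>) - (2 * k - (snd u + snd v))"
          by (rule dvd_diff[OF dvd_mult[OF that(1)] k(2)])
        then show ?thesis
          using 1 that(2) by (auto simp: offset_def cell_step_def width_def algebra_simps)
      qed
      then have "\<not> nearP u (L u v)"
        using no k by (auto simp: nearP_def pair_step_def k_def)
      moreover have "offset u v \<epsilon>" if "N dvd (snd v - k) - \<epsilon>" "\<bar>\<epsilon>\<bar> \<le> width False (fst v)" for \<epsilon>
      proof -
        have "N dvd 2 * ((snd v - k) - \<epsilon>) + (2 * k - (snd u + snd v))"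
          by (rule dvd_add[OF dvd_mult[OF that(1)] k(2)])
        then show ?thesis
          using 1 that(2) by (auto simp: offset_def cell_step_def width_def algebra_simps)
      qed
      then have "\<not> nearP (L u v) v"
        using no k by (auto simp: nearP_def pair_step_def k_def)
      moreover have "s (k - snd u) = s (snd v - k)"
        using k by (intro s_cong) (simp add: algebra_simps)
      then have "T u (L u v) = T (L u v) v"
        using 1 k by (auto simp: T_def k_def)
      ultimately show ?thesis by blast
    next
      case 2
      have k: "fst (L u v) = True" "N dvd k - (2 * snd u - snd v)"
        using L_ft[OF 2] by (simp_all add: k_def)
      have "offset u v (- \<epsilon>)" if "N dvd (k - snd u) - \<epsilon>" "\<bar>\<epsilon>\<bar> \<le> 2" for \<epsilon>
      proof -
        have "N dvd (k - (2 * snd u - snd v)) - ((k - snd u) - \<epsilon>)"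
          by (rule dvd_diff[OF k(2) that(1)])
        then show ?thesis
          using 2 that(2) by (auto simp: offset_def cell_step_def width_def algebra_simps)
      qed
      then have "\<not> nearP u (L u v)"
        using no k 2 by (auto simp: nearP_def pair_step_def width_def k_def)
      moreover have "offset u v \<epsilon>" if "N dvd (snd v - k) - 2 * \<epsilon>" "\<bar>\<epsilon>\<bar> \<le> 2" for \<epsilon>
      proof -
        have "N dvd ((snd v - k) - 2 * \<epsilon>) + (k - (2 * snd u - snd v))"
          by (rule dvd_add[OF that(1) k(2)])
        then have "N dvd 2 * ((snd v - snd u) - \<epsilon>)"
          by (simp add: algebra_simps)
        then have "N dvd (snd v - snd u) - \<epsilon>" by (rule dvd2)
        then show ?thesis
          using 2 that(2) by (auto simp: offset_def cell_step_def width_def)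
      qed
      then have "\<not> nearP (L u v) v"
        using no k 2 by (auto simp: nearP_def pair_step_def width_def k_def)
      moreover have "s (k - snd u) = s (- (snd v - snd u))"
        using k by (intro s_cong) (simp add: algebra_simps)
      moreover have "s ((snd v - k) * h) = s (snd v - snd u)"
      proof (rule s_cong, rule dvd2)
        have "N dvd (2 * ((snd v - k) * h) - (snd v - k)) - (k - (2 * snd u - snd v))"
          by (rule dvd_diff[OF half k(2)])
        then show "N dvd 2 * ((snd v - k) * h - (snd v - snd u))"
          by (simp add: algebra_simps)
      qed
      ultimately show ?thesis
        using 2 k s_minus[OF ndvd] by (auto simp: T_def k_def)
    next
      case 3
      have k: "fst (L u v) = True" "N dvd k - (2 * snd v - snd u)"
        using L_tf[OF 3] by (simp_all add: k_def)
      have "offset u v \<epsilon>" if "N dvd (k - snd u) - 2 * \<epsilon>" "\<bar>\<epsilon>\<bar> \<le> 2" for \<epsilon>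
      proof -
        have "N dvd ((k - snd u) - 2 * \<epsilon>) - (k - (2 * snd v - snd u))"
          by (rule dvd_diff[OF that(1) k(2)])
        then have "N dvd 2 * ((snd v - snd u) - \<epsilon>)"
          by (simp add: algebra_simps)
        then have "N dvd (snd v - snd u) - \<epsilon>" by (rule dvd2)
        then show ?thesis
          using 3 that(2) by (auto simp: offset_def cell_step_def width_def)
      qed
      then have "\<not> nearP u (L u v)"
        using no k 3 by (auto simp: nearP_def pair_step_def width_def k_def)
      moreover have "offset u v (- \<epsilon>)" if "N dvd (snd v - k) - \<epsilon>" "\<bar>\<epsilon>\<bar> \<le> 2" for \<epsilon>
      proof -
        have "N dvd - (((snd v - k) - \<epsilon>) + (k - (2 * snd v - snd u)))"
          unfolding dvd_minus_iff by (rule dvd_add[OF that(1) k(2)])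
        then show ?thesis
          using 3 that(2) by (auto simp: offset_def cell_step_def width_def algebra_simps)
      qed
      then have "\<not> nearP (L u v) v"
        using no k 3 by (auto simp: nearP_def pair_step_def width_def k_def)
      moreover have "s (snd v - k) = s (- (snd v - snd u))"
      proof (rule s_cong)
        have "N dvd - (k - (2 * snd v - snd u))"
          using k by (simp only: dvd_minus_iff)
        then show "N dvd (snd v - k) - (- (snd v - snd u))"
          by (simp add: algebra_simps)
      qed
      moreover have "s ((k - snd u) * h) = s (snd v - snd u)"
      proof (rule s_cong, rule dvd2)
        have "N dvd (2 * ((k - snd u) * h) - (k - snd u)) + (k - (2 * snd v - snd u))"
          by (rule dvd_add[OF half k(2)])
        then show "N dvd 2 * ((k - snd u) * h - (snd v - snd u))"
          by (simp add: algebra_simps)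
      qed
      ultimately show ?thesis
        using 3 k s_minus[OF ndvd] by (auto simp: T_def k_def)
    qed
  qed
  have I_eq: "i = j" if "N dvd i - j" "i \<in> {0..<N}" "j \<in> {0..<N}" for i j
  proof -
    have "i mod N = j mod N" using that(1) by (simp add: mod_eq_dvd_iff)
    then show ?thesis using that by simp
  qed
  have L_type: "fst (L u v) \<longleftrightarrow> fst u \<noteq> fst v" for u v
    by (simp add: L_def)
  have row: "v = v'" if "v \<in> I" "v' \<in> I" "L u v = L u v'" for u v v'
  proof -
    define k where "k = snd (L u v)"
    have k': "snd (L u v') = k" using that(3) by (simp add: k_def)
    have type: "fst v = fst v'" using L_type[of u v] L_type[of u v'] that(3) by auto
    consider "fst u = fst v" | "\<not> fst u" "fst v" | "fst u" "\<not> fst v" by blast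
    then have "N dvd snd v - snd v'"
    proof cases
      case 1
      have "N dvd (2 * k - (snd u + snd v')) - (2 * k - (snd u + snd v))"
        using 1 L_same[of u v] L_same[of u v'] type k'
        by (rule_tac dvd_diff) (simp_all add: k_def)
      then show ?thesis by simp
    next
      case 2
      have "N dvd (k - (2 * snd u - snd v)) - (k - (2 * snd u - snd v'))"
        using 2 L_ft[of u v] L_ft[of u v'] type k'
        by (rule_tac dvd_diff) (simp_all add: k_def)
      then show ?thesis by simp
    next
      case 3
      have "N dvd (k - (2 * snd v' - snd u)) - (k - (2 * snd v - snd u))"
        using 3 L_tf[of u v] L_tf[of u v'] type k'
        by (rule_tac dvd_diff) (simp_all add: k_def)
      then have "N dvd 2 * (snd v - snd v')" by simp
      then show ?thesis by (rule dvd2)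
    qed
    then have "snd v = snd v'"
      using that(1,2) by (intro I_eq) (auto simp: I_def)
    then show ?thesis using type by (simp add: prod_eq_iff)
  qed
  have col: "u = u'" if "u \<in> I" "u' \<in> I" "L u v = L u' v" for u u' v
  proof -
    define k where "k = snd (L u v)"
    have k': "snd (L u' v) = k" using that(3) by (simp add: k_def)
    have type: "fst u = fst u'" using L_type[of u v] L_type[of u' v] that(3) by auto
    consider "fst u = fst v" | "\<not> fst u" "fst v" | "fst u" "\<not> fst v" by blast
    then have "N dvd snd u - snd u'"
    proof cases
      case 1
      have "N dvd (2 * k - (snd u' + snd v)) - (2 * k - (snd u + snd v))"
        using 1 L_same[of u v] L_same[of u' v] type k'
        by (rule_tac dvd_diff) (simp_all add: k_def)
      then show ?thesis by simp
    next
      case 2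
      have "N dvd (k - (2 * snd u' - snd v)) - (k - (2 * snd u - snd v))"
        using 2 L_ft[of u v] L_ft[of u' v] type k'
        by (rule_tac dvd_diff) (simp_all add: k_def)
      then have "N dvd 2 * (snd u - snd u')" by simp
      then show ?thesis by (rule dvd2)
    next
      case 3
      have "N dvd (k - (2 * snd v - snd u)) - (k - (2 * snd v - snd u'))"
        using 3 L_tf[of u v] L_tf[of u' v] type k'
        by (rule_tac dvd_diff) (simp_all add: k_def)
      then show ?thesis by simp
    qed
    then have "snd u = snd u'"
      using that(1,2) by (intro I_eq) (auto simp: I_def)
    then show ?thesis using type by (simp add: prod_eq_iff)
  qed
  have near_orbit: "\<exists>a b \<delta> \<tau> c x i. ((a, b, \<delta>), \<tau>, c, x) \<in> set near_orbits \<and> i \<in> {0..<N} \<and>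
      e = ((a, i), (b, (i + \<delta>) mod N)) \<and> near e = (\<tau>, (c, (i + x) mod N))"
    if e: "e \<in> I \<times> I" "cls e" for e
  proof -
    obtain a i b j where ij: "e = ((a, i), (b, j))" by (metis surj_pair)
    define \<epsilon> where "\<epsilon> = (SOME \<epsilon>. offset (a, i) (b, j) \<epsilon>)"
    have "offset (a, i) (b, j) \<epsilon>"
      using e(2) unfolding \<epsilon>_def ij cls_def nearC_def prod.case by (rule someI_ex)
    then have \<epsilon>: "\<bar>\<epsilon>\<bar> \<le> width a b" "N dvd (j - i) - cell_step a b * \<epsilon>"
      by (simp_all add: offset_def)
    obtain \<tau> c x where t: "near_colour a b \<epsilon> = (\<tau>, c, x)" by (metis surj_pair)
    have "N dvd j - (i + cell_step a b * \<epsilon>)"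
      using \<epsilon>(2) by (simp add: algebra_simps)
    then have "j mod N = (i + cell_step a b * \<epsilon>) mod N"
      by (simp only: mod_eq_dvd_iff)
    moreover have ij_I: "i \<in> {0..<N}" "j mod N = j"
      using e(1) by (simp_all add: ij I_def)
    ultimately have "j = (i + cell_step a b * \<epsilon>) mod N"
      by simp
    moreover have "((a, b, cell_step a b * \<epsilon>), \<tau>, c, x) \<in> set near_orbits"
      using near_orbitsI[OF \<epsilon>(1)] unfolding t .
    moreover have "near e = (\<tau>, (c, (i + x) mod N))"
      by (simp add: near_def ij \<epsilon>_def[symmetric] t)
    ultimately show ?thesis
      using ij ij_I(1) by metis
  qed
  have near_nearP: "nearP (snd v) (snd (near e)) \<and> snd (near e) \<in> I" if e: "e \<in> I \<times> I" "cls e" and v: "snd v = fst e \<or> snd v = snd e" for e v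
  proof -
    obtain a b \<delta> \<tau> c x i where q: "((a, b, \<delta>), \<tau>, c, x) \<in> set near_orbits" and i: "i \<in> {0..<N}"
      and e: "e = ((a, i), (b, (i + \<delta>) mod N))" and ne: "near e = (\<tau>, (c, (i + x) mod N))"
      using near_orbit[OF e] by blast
    have "\<forall>((a, b, \<delta>), \<tau>, c, x)\<in>set near_orbits. multiple_le (pair_step a c) (width a c) x \<and>
        multiple_le (pair_step b c) (width b c) (x - \<delta>)"
      using near_orbits_near by (simp add: list_all_iff)
    from bspec[OF this q] have m: "multiple_le (pair_step a c) (width a c) x"
      "multiple_le (pair_step b c) (width b c) (x - \<delta>)"
      by simp_all
    have nearPI: "nearP (a, i) (c, k)" if y: "multiple_le (pair_step a c) (width a c) y" "N dvd (k - i) - y" for a c i k y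
    proof -
      obtain \<epsilon> where \<epsilon>: "y = pair_step a c * \<epsilon>"
        using y(1) by (auto simp: multiple_le_def)
      then have "\<bar>\<epsilon>\<bar> \<le> width a c"
        using y(1) by (auto simp: multiple_le_def pair_step_def abs_mult split: if_splits)
      then show ?thesis using y(2) \<epsilon> by (auto simp: nearP_def)
    qed
    have "N dvd ((i + x) mod N - i) - x"
      using mod_dvd[of "i + x"] by (simp add: algebra_simps)
    moreover have "N dvd ((i + x) mod N - (i + \<delta>) mod N) - (x - \<delta>)"
    proof -
      have "N dvd ((i + x) mod N - (i + x)) - ((i + \<delta>) mod N - (i + \<delta>))"
        by (rule dvd_diff[OF mod_dvd mod_dvd])
      then show ?thesis by (simp add: algebra_simps)
    qed
    ultimately show ?thesis
      using v m nearPI ne N(1) by (auto simp: e I_def)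
  qed
  have far_mem: "snd (far e) \<in> I" for e
    using N(1) by (cases e) (auto simp: far_def L_def I_def)
  have "harmonious_on (id \<circ> fst) (I \<times> I) C"
  proof (rule harmonious_on_by_classes[where cls = cls and \<rho> = \<rho>])
    fix \<kappa>
    show "harmonious_on (id \<circ> fst) {e \<in> I \<times> I. cls e = \<kappa>} C"
    proof (cases \<kappa>)
      case True
      have "harmonious_on (id \<circ> fst) {e \<in> I \<times> I. cls e} near"
        using near_orbit dvd_not_indivisible[OF N(3,2)]
        by (intro orbits_harmonious_on[OF N(1) _ near_orbits_harmonious]) auto
      then show ?thesis
        using True by (auto intro: harmonious_on_cong[where C = near and b = "id \<circ> fst"] simp: C_def)
    next
      case False
      have "harmonious_on (id \<circ> fst) {(u, v). u \<in> I \<and> v \<in> I \<and> \<not> nearC u v} far"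
        unfolding far_def
      proof (rule betweenness_harmonious[where Q = "\<lambda>u v. \<not> nearP u v"])
        fix u v assume "(u, v) \<in> {(u, v). u \<in> I \<and> v \<in> I \<and> \<not> nearC u v}"
        then show "u \<noteq> v \<and> \<not> nearP u (L u v) \<and> \<not> nearP (L u v) v \<and> T u (L u v) = T (L u v) v"
          using far_near[of u v] not_nearC[of u v] by auto
      next
        fix u v assume "\<not> nearP u v"
        then show "\<not> nearP v u \<and> T v u \<noteq> T u v" by (rule antisym)
      next
        fix u v v' assume "(u, v) \<in> {(u, v). u \<in> I \<and> v \<in> I \<and> \<not> nearC u v}"
          "(u, v') \<in> {(u, v). u \<in> I \<and> v \<in> I \<and> \<not> nearC u v}" "L u v = L u v'"
        then show "v = v'" by - (rule row[of v v' u], auto)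
      next
        fix u u' v assume "(u, v) \<in> {(u, v). u \<in> I \<and> v \<in> I \<and> \<not> nearC u v}"
          "(u', v) \<in> {(u, v). u \<in> I \<and> v \<in> I \<and> \<not> nearC u v}" "L u v = L u' v"
        then show "u = u'" by - (rule col[of u u' v], auto)
      qed
      moreover have "{e \<in> I \<times> I. cls e = \<kappa>} = {(u, v). u \<in> I \<and> v \<in> I \<and> \<not> nearC u v}"
        using False by (auto simp: cls_def)
      ultimately show ?thesis
        by (auto intro: harmonious_on_cong[where C = far and b = "id \<circ> fst"] simp: C_def cls_def)
    qed
  next
    fix e v assume e: "e \<in> I \<times> I" and v: "v \<in> cell_ends (id \<circ> fst) e"
    have v': "snd v = fst e \<or> snd v = snd e"
      using snd_cell_ends[of v _ "fst e" "snd e"] v by simp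
    show "\<rho> v (C e) = cls e"
    proof (cases "cls e")
      case True
      then show ?thesis using near_nearP[OF e True v'] by (simp add: \<rho>_def C_def)
    next
      case False
      then have "\<not> nearC (fst e) (snd e)"
        by (simp add: cls_def case_prod_beta)
      from far_near[OF this] show ?thesis
        using False v' nearP_sym[of "L (fst e) (snd e)" "snd e"]
        by (auto simp: \<rho>_def C_def far_def case_prod_beta)
    qed
  next
    show "\<rho> v w = \<rho> w v" for v w
      unfolding \<rho>_def by (rule nearP_sym)
  qed
  moreover have "\<forall>e\<in>I \<times> I. snd (C e) \<in> I"
  proof
    fix e assume "e \<in> I \<times> I"
    then show "snd (C e) \<in> I"
      using near_nearP[of e "(False, fst e)"] far_mem[of e] by (cases "cls e") (simp_all add: C_def)
  qed
  moreover have "inj_on (\<lambda>u. C (u, u)) I"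
  proof -
    have diag: "C (u, u) = (\<not> fst u, (\<not> fst u, (snd u + (if fst u then 2 else 0)) mod N))" for u
    proof -
      have "offset u u \<epsilon> \<longleftrightarrow> \<epsilon> = 0" for \<epsilon>
      proof
        assume "offset u u \<epsilon>"
        then have "\<bar>\<epsilon>\<bar> \<le> 2" "N dvd 2 * \<epsilon>"
          by (auto simp: offset_def cell_step_def width_def split: if_splits)
        then show "\<epsilon> = 0"
          using dvd_not_indivisible[OF N(3,2), of "2 * \<epsilon>"] by (auto simp: indivisible_def)
      qed (simp add: offset_def width_def)
      then have "cls (u, u)" "(SOME \<epsilon>. offset u u \<epsilon>) = 0"
        by (auto simp: cls_def nearC_def)
      then show ?thesis
        by (simp add: C_def near_def near_colour_def near_table_def width_def)
    qed
    show ?thesis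
    proof (rule inj_onI)
      fix u v assume u: "u \<in> I" and v: "v \<in> I" and eq: "C (u, u) = C (v, v)"
      from eq have type: "fst u = fst v"
        by (simp add: diag)
      with eq have "(snd u + (if fst u then 2 else 0)) mod N = (snd v + (if fst u then 2 else 0)) mod N"
        by (simp only: diag prod.inject)
      then have "N dvd snd u - snd v"
        by (simp add: mod_eq_dvd_iff)
      then have "snd u = snd v"
        using u v by (intro I_eq) (auto simp: I_def)
      then show "u = v" using type by (simp add: prod_eq_iff)
    qed
  qed
  ultimately have "crown I (id \<circ> fst) C"
    by (simp add: crown_def)
  moreover have "finite I" "card I = 2 * r"
    by (simp_all add: I_def N_def card_cartesian_product)
  ultimately show ?thesis
    using has_crown_iff by metis
qed

text \<open>
  The order \<open>2\<close> is a true exception, so multiples of \<open>8\<close> are reduced to a quarter only if the quarter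
  is at least \<open>4\<close>.
\<close>

theorem crown_exists: "m \<ge> 1 \<Longrightarrow> m \<noteq> 2 \<Longrightarrow> has_crown m"
proof (induction m rule: less_induct)
  case (less m)
  consider "odd m" | r where "m = 2 * r" "odd r" | r where "m = 4 * r" "odd r" | r where "m = 8 * r"
  proof -
    have "m mod 8 = 0 \<or> m mod 8 = 4 \<or> m mod 4 = 2 \<or> odd m" by presburger
    moreover have "\<exists>r. m = 8 * r" if "m mod 8 = 0" using that by presburger
    moreover have "\<exists>r. m = 4 * r \<and> odd r" if "m mod 8 = 4" using that by presburger
    moreover have "\<exists>r. m = 2 * r \<and> odd r" if "m mod 4 = 2" using that by presburger
    ultimately show thesis using that by blast
  qed
  then show ?case
  proof cases
    case 1
    then show ?thesis by (rule has_crown_odd)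
  next
    case (2 r)
    show ?thesis
    proof (cases "r \<ge> 5")
      case True
      then show ?thesis using 2 has_crown_double_odd by simp
    next
      case False
      have "r \<noteq> 1" "r \<noteq> 0" "r \<noteq> 2" "r \<noteq> 4" using less.prems 2 by auto
      then have "r = 3" using False by linarith
      then show ?thesis using 2 has_crown_6 by simp
    qed
  next
    case (3 r)
    then show ?thesis using has_crown_mult_odd[OF _ has_crown_4, of r] by (simp add: mult.commute)
  next
    case (4 r)
    show ?thesis
    proof (cases "r = 1")
      case True
      then show ?thesis using 4 has_crown_8 by simp
    next
      case False
      then have "has_crown (2 * r)" using 4 less.prems by (intro less.IH) auto
      then show ?thesis using has_crown_mult_4 4 by blast
    qed
  qed
qed

section \<open>Complete graphs\<close>

text \<open>
  The vertex \<open>v\<close> has the colour \<open>Inl v\<close>, and \<open>k u v\<close> is the colour of the edge \<open>uv\<close>, which is the colour of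
  a vertex or one of \<open>q\<close> extra colours \<open>Inr i\<close>.
\<close>

definition complete_harmonious :: "'w set \<Rightarrow> nat \<Rightarrow> ('w \<Rightarrow> 'w \<Rightarrow> 'w + nat) \<Rightarrow> bool" where
  "complete_harmonious W q k \<longleftrightarrow>
     (\<forall>u\<in>W. \<forall>v\<in>W. u \<noteq> v \<longrightarrow> k u v = k v u \<and> k u v \<in> W <+> {..<q}) \<and>
     (\<forall>u\<in>W. \<forall>v\<in>W. \<forall>v'\<in>W. u \<noteq> v \<and> u \<noteq> v' \<and> k u v = k u v' \<longrightarrow> v = v') \<and>
     (\<forall>u\<in>W. \<forall>u'\<in>W. \<forall>v\<in>W. \<forall>v'\<in>W. u \<noteq> u' \<and> v \<noteq> v' \<longrightarrow> \<not> (k u u' = Inl v \<and> k v v' = Inl u))"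

lemma complete_harmoniousD:
  assumes "complete_harmonious W q k" "u \<in> W" "v \<in> W" "u \<noteq> v"
  shows "k u v = k v u" and "k u v \<in> W <+> {..<q}"
    and "v' \<in> W \<Longrightarrow> u \<noteq> v' \<Longrightarrow> k u v = k u v' \<Longrightarrow> v = v'"
    and "w \<in> W \<Longrightarrow> w' \<in> W \<Longrightarrow> w \<noteq> w' \<Longrightarrow> k u v = Inl w \<Longrightarrow> k w w' = Inl u \<Longrightarrow> False"
  using assms unfolding complete_harmonious_def by metis+

lemma complete_harmonious_transport:
  assumes f: "bij_betw f V W" and k: "complete_harmonious W q k"
  shows "\<exists>k. complete_harmonious V q k"
proof -
  let ?g = "inv_into V f"
  define k' where "k' = (\<lambda>u v. map_sum ?g id (k (f u) (f v)))"
  have f_mem: "f v \<in> W" if "v \<in> V" for v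
    using f that by (auto simp: bij_betw_def)
  have f_inj: "f u \<noteq> f v" if "u \<in> V" "v \<in> V" "u \<noteq> v" for u v
    using f that by (auto simp: bij_betw_def inj_on_def)
  have g: "?g w \<in> V" "f (?g w) = w" if "w \<in> W" for w
    using f that by (auto simp: bij_betw_def inv_into_into f_inv_into_f)
  have k': "map_sum f id (k' u v) = k (f u) (f v)" if "u \<in> V" "v \<in> V" "u \<noteq> v" for u v
    using complete_harmoniousD(2)[OF k f_mem f_mem f_inj, of u v] that g(2) by (auto simp: k'_def)
  have "complete_harmonious V q k'"
    unfolding complete_harmonious_def
  proof (intro conjI ballI impI notI)
    fix u v assume uv: "u \<in> V" "v \<in> V" "u \<noteq> v"
    show "k' u v = k' v u"
      using complete_harmoniousD(1)[OF k f_mem f_mem f_inj, of u v] uv by (simp add: k'_def)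
    show "k' u v \<in> V <+> {..<q}"
      using complete_harmoniousD(2)[OF k f_mem f_mem f_inj, of u v] uv g(1) by (auto simp: k'_def)
  next
    fix u v v' assume uv: "u \<in> V" "v \<in> V" "v' \<in> V" and eq: "u \<noteq> v \<and> u \<noteq> v' \<and> k' u v = k' u v'"
    then have "k (f u) (f v) = k (f u) (f v')"
      using k'[of u v] k'[of u v'] by simp
    then have "f v = f v'"
      using complete_harmoniousD(3)[OF k f_mem f_mem f_inj f_mem f_inj] uv eq by blast
    then show "v = v'" using f_inj uv by blast
  next
    fix u u' v v' assume uv: "u \<in> V" "u' \<in> V" "v \<in> V" "v' \<in> V" "u \<noteq> u' \<and> v \<noteq> v'"
      and eq: "k' u u' = Inl v \<and> k' v v' = Inl u"
    then have "k (f u) (f u') = Inl (f v)" "k (f v) (f v') = Inl (f u)"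
      using k'[of u u'] k'[of v v'] by simp_all
    then show False
      using complete_harmoniousD(4)[OF k f_mem f_mem f_inj f_mem f_mem f_inj] uv by blast
  qed
  then show ?thesis by blast
qed

text \<open>
  The edges in \<open>X\<close> receive extra colours by the addition table of \<open>\<int>\<^sub>q\<close>, which is a symmetric Latin
  square: it suffices that the \<open>X\<close>-neighbours of each vertex have distinct labels. In particular a
  rung \<open>x\<^sub>iy\<^sub>i\<close> may take the diagonal value \<open>2i\<close>, since no edge in the cliques at \<open>x\<^sub>i\<close> or \<open>y\<^sub>i\<close> has it.
\<close>

lemma complete_harmonious_by_sums:
  fixes lab :: "'w \<Rightarrow> nat"
  assumes lab: "\<And>u. u \<in> W \<Longrightarrow> lab u < q"
    and sym: "\<And>u v. u \<in> W \<Longrightarrow> v \<in> W \<Longrightarrow> u \<noteq> v \<Longrightarrow> X u v = X v u \<and> (X u v \<or> c u v = c v u)"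
    and mem: "\<And>u v. u \<in> W \<Longrightarrow> v \<in> W \<Longrightarrow> u \<noteq> v \<Longrightarrow> \<not> X u v \<Longrightarrow> c u v \<in> W"
    and lab_inj: "\<And>u v v'. u \<in> W \<Longrightarrow> v \<in> W \<Longrightarrow> v' \<in> W \<Longrightarrow> u \<noteq> v \<Longrightarrow> u \<noteq> v' \<Longrightarrow>
      X u v \<Longrightarrow> X u v' \<Longrightarrow> lab v = lab v' \<Longrightarrow> v = v'"
    and c_inj: "\<And>u v v'. u \<in> W \<Longrightarrow> v \<in> W \<Longrightarrow> v' \<in> W \<Longrightarrow> u \<noteq> v \<Longrightarrow> u \<noteq> v' \<Longrightarrow>
      \<not> X u v \<Longrightarrow> \<not> X u v' \<Longrightarrow> c u v = c u v' \<Longrightarrow> v = v'"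
    and c_antisym: "\<And>u u' v v'. u \<in> W \<Longrightarrow> u' \<in> W \<Longrightarrow> v \<in> W \<Longrightarrow> v' \<in> W \<Longrightarrow> u \<noteq> u' \<Longrightarrow> v \<noteq> v' \<Longrightarrow>
      \<not> X u u' \<Longrightarrow> \<not> X v v' \<Longrightarrow> c u u' = v \<Longrightarrow> c v v' = u \<Longrightarrow> False"
  shows "\<exists>k. complete_harmonious W q k"
proof -
  define k where "k = (\<lambda>u v. if X u v then Inr ((lab u + lab v) mod q) else Inl (c u v))"
  have "complete_harmonious W q k"
    unfolding complete_harmonious_def
  proof (intro conjI ballI impI notI)
    fix u v assume uv: "u \<in> W" "v \<in> W" "u \<noteq> v"
    show "k u v = k v u"
      using sym[OF uv] by (auto simp: k_def add.commute)
    show "k u v \<in> W <+> {..<q}"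
      using mem[OF uv] lab[OF uv(1)] by (auto simp: k_def)
  next
    fix u v v' assume uv: "u \<in> W" "v \<in> W" "v' \<in> W" and *: "u \<noteq> v \<and> u \<noteq> v' \<and> k u v = k u v'"
    show "v = v'"
    proof (cases "X u v")
      case True
      then have X: "X u v'" and "(lab u + lab v) mod q = (lab u + lab v') mod q"
        using * by (auto simp: k_def split: if_splits)
      then have "lab v mod q = lab v' mod q"
        by (metis cong_add_lcancel_nat cong_def)
      then show ?thesis
        using lab_inj[of u v v'] uv * True X lab[of v] lab[of v'] by simp
    next
      case False
      then have "\<not> X u v'" "c u v = c u v'"
        using * by (auto simp: k_def split: if_splits)
      then show ?thesis using c_inj[of u v v'] uv * False by blast
    qed
  next
    fix u u' v v' assume uv: "u \<in> W" "u' \<in> W" "v \<in> W" "v' \<in> W" "u \<noteq> u' \<and> v \<noteq> v'"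
      and "k u u' = Inl v \<and> k v v' = Inl u"
    then have "\<not> X u u'" "\<not> X v v'" "c u u' = v" "c v v' = u"
      by (auto simp: k_def split: if_splits)
    then show False using c_antisym uv by blast
  qed
  then show ?thesis by blast
qed

definition cell :: "bool \<times> nat \<Rightarrow> bool \<times> nat \<Rightarrow> nat \<times> nat" where
  "cell u v = (if fst u then (snd v, snd u) else (snd u, snd v))"

lemma cell_ends_cell:
  "fst u \<noteq> fst v \<Longrightarrow> snd u \<noteq> snd v \<Longrightarrow> cell_ends b (cell u v) = {u, v}"
  by (cases u; cases v) (auto simp: cell_def cell_ends_def)

lemma cell_in: "snd u < m \<Longrightarrow> snd v < m \<Longrightarrow> cell u v \<in> {..<m} \<times> {..<m}"
  by (auto simp: cell_def)

lemma cell_cancel: "fst u \<noteq> fst v \<Longrightarrow> fst u \<noteq> fst v' \<Longrightarrow> cell u v = cell u v' \<Longrightarrow> v = v'"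
  by (auto simp: cell_def prod_eq_iff split: if_splits)

lemma complete_harmonious_even:
  assumes "has_crown m"
  shows "\<exists>k. complete_harmonious ((UNIV :: bool set) \<times> {..<m}) m k"
proof -
  obtain b C where C: "crown {..<m} b C"
    using assms by (auto simp: has_crown_def)
  have H: "harmonious_on b ({..<m} \<times> {..<m}) C" and C_in: "\<And>e. e \<in> {..<m} \<times> {..<m} \<Longrightarrow> snd (C e) < m"
    using C by (auto simp: crown_def)
  show ?thesis
  proof (rule complete_harmonious_by_sums[where lab = snd and X = "\<lambda>u v. fst u = fst v \<or> snd u = snd v"
        and c = "\<lambda>u v. C (cell u v)"], goal_cases)
    case (2 u v)
    show ?case by (cases "fst u"; cases "fst v") (auto simp: cell_def)
  next
    case (3 u v)
    then have "snd (C (cell u v)) < m"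
      by (intro C_in cell_in) auto
    then show ?case by (cases "C (cell u v)") auto
  next
    case (4 u v v')
    then show ?case by (auto simp: prod_eq_iff)
  next
    case (5 u v v')
    have "cell u v = cell u v'"
      using 5 by (intro harmonious_onD(1)[OF H cell_in cell_in, of _ _ _ _ u]) (auto simp: cell_ends_cell)
    then show ?case using 5 cell_cancel by blast
  next
    case (6 u u' v v')
    show ?case
      using 6 by (intro harmonious_onD(2)[OF H cell_in cell_in, of u u' v v']) (auto simp: cell_ends_cell)
  qed auto
qed

text \<open>
  The vertex \<open>\<infinity>\<close> is \<open>None\<close> and has the label \<open>0\<close>, the other vertices have the labels \<open>1, \<dots>, m\<close>. At \<open>\<infinity>\<close> the
  labels of its \<open>X\<close>-neighbours are distinct, because for each \<open>i\<close> exactly one of \<open>x\<^sub>i\<close> and \<open>y\<^sub>i\<close> is among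
  them; the edge to the other one is the diagonal cell \<open>(i, i)\<close>.
\<close>

lemma complete_harmonious_odd:
  assumes "has_crown m"
  shows "\<exists>k. complete_harmonious (insert None (Some ` ((UNIV :: bool set) \<times> {..<m}))) (m + 1) k"
proof -
  obtain b C where C: "crown {..<m} b C"
    using assms by (auto simp: has_crown_def)
  define W where "W = insert None (Some ` ((UNIV :: bool set) \<times> {..<m}))"
  have H: "harmonious_on b ({..<m} \<times> {..<m}) C" and C_in: "\<And>e. e \<in> {..<m} \<times> {..<m} \<Longrightarrow> snd (C e) < m"
    and inj: "inj_on (\<lambda>i. C (i, i)) {..<m}"
    using C by (auto simp: crown_def)
  define lab where "lab = case_option 0 (\<lambda>v :: bool \<times> nat. snd v + 1)"
  define s where "s = (\<lambda>v. fst v = b (snd v))"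
  define X where "X = (\<lambda>u v. case (u, v) of (Some u, Some v) \<Rightarrow> fst u = fst v \<or> snd u = snd v
    | (None, Some v) \<Rightarrow> \<not> s v | (Some u, None) \<Rightarrow> \<not> s u | (None, None) \<Rightarrow> True)"
  define e where "e = (\<lambda>u v. case (u, v) of (Some u, Some v) \<Rightarrow> cell u v
    | (None, Some v) \<Rightarrow> (snd v, snd v) | (Some u, None) \<Rightarrow> (snd u, snd u) | (None, None) \<Rightarrow> (0, 0))"
  have W_cases: "u = None \<or> (\<exists>u'. u = Some u' \<and> snd u' < m)" if "u \<in> W" for u
    using that by (auto simp: W_def)
  have e_in: "e u v \<in> {..<m} \<times> {..<m}" if "u \<in> W" "v \<in> W" "u \<noteq> v" for u v
    using W_cases[OF that(1)] W_cases[OF that(2)] that(3) by (auto simp: e_def cell_def split: if_splits)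
  have ends: "Some ` cell_ends b (e u v) = {u, v} - {None}" if "u \<in> W" "v \<in> W" "u \<noteq> v" "\<not> X u v" for u v
    using W_cases[OF that(1)] W_cases[OF that(2)] that(3,4)
    by (auto simp: X_def e_def s_def cell_ends_cell prod_eq_iff)
  have ends': "u \<in> cell_ends b (e (Some u) v)" if "Some u \<in> W" "v \<in> W" "Some u \<noteq> v" "\<not> X (Some u) v" for u v
    using ends[OF that] by auto
  have "\<exists>k. complete_harmonious W (m + 1) k"
  proof (rule complete_harmonious_by_sums[where lab = lab and X = X and c = "\<lambda>u v. Some (C (e u v))"], goal_cases)
    case (1 u)
    then show ?case using W_cases[of u] by (auto simp: lab_def)
  next
    case (2 u v)
    then show ?case
      by (cases u; cases v) (auto simp: X_def e_def cell_def)
  next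
    case (3 u v)
    then have "snd (C (e u v)) < m"
      by (intro C_in e_in)
    then show ?case by (cases "C (e u v)") (auto simp: W_def)
  next
    case (4 u v v')
    then show ?case
      by (cases u; cases v; cases v') (auto simp: X_def lab_def s_def prod_eq_iff)
  next
    case (5 u v v')
    then have eq: "C (e u v) = C (e u v')" by simp
    show ?case
    proof (cases u)
      case None
      then obtain w w' where w: "v = Some w" "v' = Some w'" "snd w < m" "snd w' < m" "s w" "s w'"
        using 5 W_cases[of v] W_cases[of v'] by (auto simp: X_def)
      then have "snd w = snd w'"
        using eq None by (intro inj_onD[OF inj]) (auto simp: e_def)
      then show ?thesis using w by (simp add: s_def prod_eq_iff)
    next
      case (Some w)
      have "e u v = e u v'"
        using 5 Some by (intro harmonious_onD(1)[OF H e_in e_in _ _ eq, of w]) (auto intro: ends')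
      then have "{u, v} - {None} = {u, v'} - {None}"
        using ends[of u v] ends[of u v'] 5 by simp
      from arg_cong[OF this, of "\<lambda>A. v \<in> A"] arg_cong[OF this, of "\<lambda>A. v' \<in> A"]
      have "v = None \<or> v = v'" "v' = None \<or> v = v'"
        using 5(4,5) by auto
      then show ?thesis by auto
    qed
  next
    case (6 u u' v v')
    then have w: "u = Some (C (e v v'))" "v = Some (C (e u u'))"
      by simp_all
    have "C (e v v') \<in> cell_ends b (e u u')"
      using ends'[of "C (e v v')" u', folded w(1)] 6(1,2,5,7) by simp
    moreover have "C (e u u') \<in> cell_ends b (e v v')"
      using ends'[of "C (e u u')" v', folded w(2)] 6(3,4,6,8) by simp
    ultimately show ?case
      by (rule harmonious_onD(2)[OF H e_in[OF 6(1,2,5)] e_in[OF 6(3,4,6)]])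
  qed
  then show ?thesis by (simp add: W_def)
qed

text \<open>
  On \<open>\<int>\<^sub>5\<close>, the edge \<open>{i, i + 1}\<close> has the colour of the vertex \<open>i - 1\<close>, and the pentagon of the other edges
  has three extra colours. The diagonal is a dummy.
\<close>

definition k5_table :: "(nat + nat) list list" where
  "k5_table =
    (let v = Inl; c = Inr in
     [[c 0, v 4, c 0, c 2, v 3],
      [v 4, c 0, v 0, c 1, c 0],
      [c 0, v 0, c 0, v 1, c 1],
      [c 2, c 1, v 1, c 0, v 2],
      [v 3, c 0, c 1, v 2, c 0]])"

lemma complete_harmonious_5: "complete_harmonious {0..<5} 3 (\<lambda>u v. k5_table ! u ! v)"
proof -
  define k where "k = (\<lambda>u v. k5_table ! u ! v)"
  define ns :: "nat list" where "ns = [0..<5]"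
  have "list_all (\<lambda>u. list_all (\<lambda>v. u \<noteq> v \<longrightarrow> k u v = k v u \<and>
      (case k u v of Inl w \<Rightarrow> w < 5 | Inr w \<Rightarrow> w < 3)) ns) ns"
    unfolding k_def ns_def by code_simp
  then have sym: "k u v = k v u" and mem: "case k u v of Inl w \<Rightarrow> w < 5 | Inr w \<Rightarrow> w < 3"
    if "u \<in> set ns" "v \<in> set ns" "u \<noteq> v" for u v
    using that unfolding list_all_iff by blast+
  have "list_all (\<lambda>u. list_all (\<lambda>v. list_all (\<lambda>v'. u \<noteq> v \<and> u \<noteq> v' \<and> k u v = k u v' \<longrightarrow> v = v') ns) ns) ns"
    unfolding k_def ns_def by code_simp
  then have cancel: "u \<noteq> v \<and> u \<noteq> v' \<and> k u v = k u v' \<Longrightarrow> v = v'"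
    if "u \<in> set ns" "v \<in> set ns" "v' \<in> set ns" for u v v'
    using that unfolding list_all_iff by blast
  have "list_all (\<lambda>u. list_all (\<lambda>u'. list_all (\<lambda>v. list_all (\<lambda>v'. u \<noteq> u' \<and> v \<noteq> v' \<longrightarrow>
      \<not> (k u u' = Inl v \<and> k v v' = Inl u)) ns) ns) ns) ns"
    unfolding k_def ns_def by code_simp
  then have antisym: "\<not> (k u u' = Inl v \<and> k v v' = Inl u)"
    if "u \<in> set ns" "u' \<in> set ns" "v \<in> set ns" "v' \<in> set ns" "u \<noteq> u' \<and> v \<noteq> v'" for u u' v v'
    using that unfolding list_all_iff by blast
  have "complete_harmonious (set ns) 3 k"
    unfolding complete_harmonious_def
  proof (intro conjI ballI impI)
    fix u v assume uv: "u \<in> set ns" "v \<in> set ns" "u \<noteq> v"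
    show "k u v = k v u" using uv by (rule sym)
    show "k u v \<in> set ns <+> {..<3}"
      using mem[OF uv] by (cases "k u v") (auto simp: ns_def)
  qed (use cancel antisym in blast)+
  then show ?thesis by (simp add: ns_def k_def)
qed

lemma complete_harmonious_exists:
  assumes V: "finite V" "card V \<ge> 2" "card V \<noteq> 4"
  shows "\<exists>k. complete_harmonious V ((card V + 1) div 2) k"
proof -
  have transport: "\<exists>k. complete_harmonious V q k" if "complete_harmonious W q k" "finite W" "card W = card V"
    for W :: "'w set" and q k
    using that V(1) finite_same_card_bij[of V W] complete_harmonious_transport by metis
  define m where "m = card V div 2"
  consider "card V = 5" | "card V = 2 * m" "has_crown m" | "card V = 2 * m + 1" "has_crown m"
  proof -
    have "card V = 2 * m \<or> card V = 2 * m + 1" "m \<ge> 1" "m = 2 \<longrightarrow> card V = 5"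
      using V by (auto simp: m_def)
    then show thesis using that crown_exists[of m] by auto
  qed
  then show ?thesis
  proof cases
    case 1
    then show ?thesis using transport[OF complete_harmonious_5] by simp
  next
    case 2
    then show ?thesis
      using complete_harmonious_even[of m] transport[of "(UNIV :: bool set) \<times> {..<m}" m]
      by (auto simp: card_cartesian_product)
  next
    case 3
    have "card (insert None (Some ` ((UNIV :: bool set) \<times> {..<m}))) = 2 * m + 1"
      by (subst card_insert_disjoint) (auto simp: card_image card_cartesian_product)
    then show ?thesis
      using 3 complete_harmonious_odd[of m] transport[of "insert None (Some ` ((UNIV :: bool set) \<times> {..<m}))" "m + 1"]
      by auto
  qed
qed

section \<open>Multigraphs\<close>

text \<open>
  Vertices are numbered from \<open>0\<close>, and edges are coloured by sums modulo an odd \<open>N\<close>. For an even number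
  of vertices the last one has the number \<open>N\<close> and is joined to \<open>i\<close> with the colour \<open>2i\<close>, the only one
  that does not occur at \<open>i\<close> otherwise.
\<close>

lemma proper_edge_colouring_complete:
  assumes V: "finite V" "card V \<ge> 2"
  shows "\<exists>f :: 'v \<Rightarrow> 'v \<Rightarrow> nat.
    (\<forall>u\<in>V. \<forall>v\<in>V. u \<noteq> v \<longrightarrow> f u v = f v u \<and> f u v < 2 * ((card V + 1) div 2) - 1) \<and>
    (\<forall>u\<in>V. \<forall>v\<in>V. \<forall>v'\<in>V. u \<noteq> v \<and> u \<noteq> v' \<and> f u v = f u v' \<longrightarrow> v = v')"
proof -
  define N where "N = 2 * ((card V + 1) div 2) - 1"
  have N: "odd N" "card V \<le> N + 1" "N > 0"
    using V by (auto simp: N_def)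
  obtain h where h: "bij_betw h V {0..<card V}"
    using ex_bij_betw_finite_nat[OF V(1)] by blast
  have le: "h v \<le> N" if "v \<in> V" for v
    using bij_betwE[OF h] that N(2) by fastforce
  have inj: "u = v" if "h u = h v" "u \<in> V" "v \<in> V" for u v
    using h that by (auto simp: bij_betw_def inj_on_def)
  define g where "g = (\<lambda>i j. if i = N then (2 * j) mod N else if j = N then (2 * i) mod N else (i + j) mod N)"
  have add: "i = j" if "(x + i) mod N = (x + j) mod N" "i < N" "j < N" for x i j
    using that by (metis cong_add_lcancel_nat cong_def mod_less)
  have double: "i = j" if "(2 * i) mod N = (2 * j) mod N" "i < N" "j < N" for i j
  proof -
    have "[2 * i = 2 * j] (mod N)" "coprime 2 N"
      using that N by (simp_all add: cong_def)
    then show ?thesis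
      using that by (metis cong_mult_lcancel_nat cong_def mod_less)
  qed
  have g_sym: "g i j = g j i" for i j
    by (auto simp: g_def add.commute)
  have g_inj: "j = j'" if "i \<le> N" "j \<le> N" "j' \<le> N" "i \<noteq> j" "i \<noteq> j'" "g i j = g i j'" for i j j'
  proof (cases "i = N")
    case True
    then show ?thesis using that double[of j j'] by (simp add: g_def)
  next
    case False
    have "x = y" if "x \<le> N" "y \<le> N" "i \<noteq> x" "i \<noteq> y" "g i x = g i y" "x \<noteq> N" for x y
    proof (cases "y = N")
      case True
      then have "(i + x) mod N = (i + i) mod N"
        using that False by (simp add: g_def mult_2)
      then show ?thesis using add[of i x i] that \<open>i \<le> N\<close> False by simp
    next
      case False
      then show ?thesis using add[of i x y] that \<open>i \<noteq> N\<close> by (simp add: g_def)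
    qed
    then show ?thesis using that by metis
  qed
  have "g i j < N" for i j
    using N by (simp add: g_def)
  then have "(\<forall>u\<in>V. \<forall>v\<in>V. u \<noteq> v \<longrightarrow> g (h u) (h v) = g (h v) (h u) \<and> g (h u) (h v) < N) \<and>
    (\<forall>u\<in>V. \<forall>v\<in>V. \<forall>v'\<in>V. u \<noteq> v \<and> u \<noteq> v' \<and> g (h u) (h v) = g (h u) (h v') \<longrightarrow> v = v')"
    using g_sym g_inj le inj by metis
  then show ?thesis
    unfolding N_def by (intro exI[of _ "\<lambda>u v. g (h u) (h v)"])
qed

context multigraph
begin

lemma harmonious_total_chromatic_number_le:
  fixes c :: "'v + 'e \<Rightarrow> 'c"
  assumes c: "harmonious_total_colouring G c"
  shows "harmonious_total_chromatic_number G \<le> num_colours G c"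
proof -
  let ?D = "verts G <+> edges G"
  have "finite ?D"
    using finite_verts finite_edges by simp
  then obtain h :: "'c \<Rightarrow> nat" where h: "inj_on h (c ` ?D)"
    using finite_imp_inj_to_nat_seg[of "c ` ?D"] by blast
  have h_iff: "h (c x) = h (c y) \<longleftrightarrow> c x = c y" if "x \<in> ?D" "y \<in> ?D" for x y
    using inj_on_eq_iff[OF h] that by blast
  have tc: "total_colouring G c"
    using c by (simp add: harmonious_total_colouring_def)
  have "total_colouring G (h \<circ> c)"
    unfolding total_colouring_def
  proof (intro conjI allI impI ballI)
    fix u v assume uv: "adjacent_verts G u v"
    then have "u \<in> verts G" "v \<in> verts G"
      using ends_subset by (auto simp: adjacent_verts_def)
    moreover have "c (Inl u) \<noteq> c (Inl v)"
      using tc uv by (simp add: total_colouring_def)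
    ultimately show "(h \<circ> c) (Inl u) \<noteq> (h \<circ> c) (Inl v)"
      using h_iff by (simp add: InlI InrI)
  next
    fix e f assume ef: "adjacent_edges G e f"
    then have "e \<in> edges G" "f \<in> edges G"
      by (simp_all add: adjacent_edges_def)
    moreover have "c (Inr e) \<noteq> c (Inr f)"
      using tc ef by (simp add: total_colouring_def)
    ultimately show "(h \<circ> c) (Inr e) \<noteq> (h \<circ> c) (Inr f)"
      using h_iff by (simp add: InlI InrI)
  next
    fix x assume x: "x \<in> incident_pairs G"
    then have "fst x \<in> verts G" "snd x \<in> edges G"
      by (auto simp: incident_pairs_def)
    moreover have "c (Inl (fst x)) \<noteq> c (Inr (snd x))"
      using tc x unfolding total_colouring_def by (simp add: case_prod_beta)
    ultimately show "case x of (v, e) \<Rightarrow> (h \<circ> c) (Inl v) \<noteq> (h \<circ> c) (Inr e)"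
      using h_iff by (simp add: case_prod_beta InlI InrI)
  qed
  moreover have "inj_on (\<lambda>(v, e). {(h \<circ> c) (Inl v), (h \<circ> c) (Inr e)}) (incident_pairs G)"
  proof (rule inj_onI)
    fix x y assume x: "x \<in> incident_pairs G" and y: "y \<in> incident_pairs G"
      and eq: "(\<lambda>(v, e). {(h \<circ> c) (Inl v), (h \<circ> c) (Inr e)}) x = (\<lambda>(v, e). {(h \<circ> c) (Inl v), (h \<circ> c) (Inr e)}) y"
    let ?p = "\<lambda>x. {c (Inl (fst x)), c (Inr (snd x))}"
    have sub: "?p x \<subseteq> c ` ?D" "?p y \<subseteq> c ` ?D"
      using x y by (auto simp: incident_pairs_def)
    have "h ` ?p x = h ` ?p y"
      using eq by (simp add: case_prod_beta)
    then have "?p x = ?p y"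
      using inj_on_image_eq_iff[OF h sub] by simp
    then show "x = y"
      using c x y unfolding harmonious_total_colouring_def inj_on_def by (simp add: case_prod_beta)
  qed
  ultimately have "harmonious_total_colouring G (h \<circ> c)"
    by (simp add: harmonious_total_colouring_def)
  moreover have "num_colours G (h \<circ> c) = num_colours G c"
    using card_image[OF h] by (simp add: num_colours_def image_comp)
  ultimately show ?thesis
    unfolding harmonious_total_chromatic_number_def by (intro Least_le) blast
qed

lemma edges_between_le:
  assumes "u \<in> verts G" "v \<in> verts G" "u \<noteq> v"
  shows "card (edges_between G u v) \<le> max_multiplicity G"
proof -
  let ?S = "{card (edges_between G u v) |u v. u \<in> verts G \<and> v \<in> verts G \<and> u \<noteq> v}"
  have "?S \<subseteq> (\<lambda>(u, v). card (edges_between G u v)) ` (verts G \<times> verts G)"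
    by auto
  then have "finite ?S"
    by (rule finite_subset) (simp add: finite_verts)
  then show ?thesis
    unfolding max_multiplicity_def by (rule Max_ge) (use assms in blast)
qed

lemma ends_cases:
  assumes "e \<in> edges G"
  obtains u v where "ends G e = {u, v}" "u \<noteq> v" "u \<in> verts G" "v \<in> verts G"
proof -
  obtain u v where "ends G e = {u, v}" "u \<noteq> v"
    using card_ends[OF assms] by (auto simp: card_2_iff)
  then show thesis
    using that ends_subset[OF assms] by blast
qed

text \<open>
  The edges of each parallel class are numbered, which splits the multigraph into layers without
  parallel edges.
\<close>

lemma parallel_index:
  obtains p :: "'e \<Rightarrow> nat" where "\<And>e. e \<in> edges G \<Longrightarrow> p e < max_multiplicity G"
    and "\<And>e f. e \<in> edges G \<Longrightarrow> f \<in> edges G \<Longrightarrow> ends G e = ends G f \<Longrightarrow> p e = p f \<Longrightarrow> e = f"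
proof -
  define par where "par = (\<lambda>A. {e \<in> edges G. ends G e = A})"
  have fin: "finite (par A)" for A
    using finite_edges by (simp add: par_def)
  have "\<exists>h. bij_betw h (par A) {0..<card (par A)}" for A
    using ex_bij_betw_finite_nat[OF fin] .
  then obtain h where h: "\<And>A. bij_betw (h A) (par A) {0..<card (par A)}"
    by metis
  show thesis
  proof (rule that[of "\<lambda>e. h (ends G e) e"])
    fix e assume e: "e \<in> edges G"
    obtain u v where uv: "ends G e = {u, v}" "u \<noteq> v" "u \<in> verts G" "v \<in> verts G"
      using ends_cases[OF e] .
    have "h (ends G e) e < card (par (ends G e))"
      using bij_betwE[OF h[of "ends G e"]] e by (simp add: par_def)
    also have "\<dots> = card (edges_between G u v)"
      by (simp add: par_def edges_between_def uv(1))
    also have "\<dots> \<le> max_multiplicity G"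
      using edges_between_le uv by blast
    finally show "h (ends G e) e < max_multiplicity G" .
  next
    fix e f assume ef: "e \<in> edges G" "f \<in> edges G" "ends G e = ends G f" "h (ends G e) e = h (ends G f) f"
    then have "e \<in> par (ends G e)" "f \<in> par (ends G e)"
      by (simp_all add: par_def)
    then show "e = f"
      using h[of "ends G e"] ef(3,4) by (auto simp: bij_betw_def inj_on_def)
  qed
qed

text \<open>
  The layer \<open>0\<close> is coloured by \<open>k\<close>, and the layer \<open>i > 0\<close> by a copy of a proper edge colouring of the
  complete graph with colours of its own.
\<close>

theorem harmonious_total_chromatic_number_bound:
  assumes k: "complete_harmonious (verts G) q k" and card: "card (verts G) \<ge> 2"
  shows "harmonious_total_chromatic_number G
    \<le> card (verts G) + q + (max_multiplicity G - 1) * (2 * ((card (verts G) + 1) div 2) - 1)"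
proof -
  define N where "N = 2 * ((card (verts G) + 1) div 2) - 1"
  obtain f :: "'v \<Rightarrow> 'v \<Rightarrow> nat" where F:
    "(\<forall>u\<in>verts G. \<forall>v\<in>verts G. u \<noteq> v \<longrightarrow> f u v = f v u \<and> f u v < N) \<and>
     (\<forall>u\<in>verts G. \<forall>v\<in>verts G. \<forall>v'\<in>verts G. u \<noteq> v \<and> u \<noteq> v' \<and> f u v = f u v' \<longrightarrow> v = v')"
    using proper_edge_colouring_complete[OF finite_verts card] unfolding N_def by (rule exE)
  have f: "f u v = f v u \<and> f u v < N" if "u \<in> verts G" "v \<in> verts G" "u \<noteq> v" for u v
    using conjunct1[OF F] that by blast
  have f_inj: "v = v'" if "u \<in> verts G" "v \<in> verts G" "v' \<in> verts G" "u \<noteq> v" "u \<noteq> v'" "f u v = f u v'" for u v v'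
    using conjunct2[OF F] that by blast
  obtain p :: "'e \<Rightarrow> nat" where p: "\<And>e. e \<in> edges G \<Longrightarrow> p e < max_multiplicity G"
    and p_inj: "\<And>e f. e \<in> edges G \<Longrightarrow> f \<in> edges G \<Longrightarrow> ends G e = ends G f \<Longrightarrow> p e = p f \<Longrightarrow> e = f"
    by (rule parallel_index) blast
  have "\<forall>e\<in>edges G. \<exists>uv. ends G e = {fst uv, snd uv} \<and> fst uv \<noteq> snd uv"
    using ends_cases by (metis fst_conv snd_conv)
  then obtain r where r: "\<And>e. e \<in> edges G \<Longrightarrow> ends G e = {fst (r e), snd (r e)} \<and> fst (r e) \<noteq> snd (r e)"
    by metis
  define g :: "nat \<Rightarrow> 'v \<Rightarrow> 'v \<Rightarrow> ('v + nat) + (nat \<times> nat)"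
    where "g = (\<lambda>i u v. if i = 0 then Inl (k u v) else Inr (i, f u v))"
  define c where "c = case_sum (\<lambda>v. Inl (Inl v)) (\<lambda>e. g (p e) (fst (r e)) (snd (r e)))"
  have edge: "\<exists>u. ends G e = {v, u} \<and> v \<noteq> u \<and> v \<in> verts G \<and> u \<in> verts G \<and> c (Inr e) = g (p e) v u"
    if "e \<in> edges G" "v \<in> ends G e" for e v
  proof -
    have mem: "fst (r e) \<in> verts G" "snd (r e) \<in> verts G"
      using r[OF that(1)] ends_subset[OF that(1)] by auto
    have "g (p e) (fst (r e)) (snd (r e)) = g (p e) (snd (r e)) (fst (r e))"
      using complete_harmoniousD(1)[OF k mem] f[OF mem] r[OF that(1)] by (simp add: g_def)
    then show ?thesis
      using r[OF that(1)] that(2) mem by (auto simp: c_def)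
  qed
  have proper: "e = e'" if e: "e \<in> edges G" "e' \<in> edges G" and v: "v \<in> ends G e" "v \<in> ends G e'"
    and eq: "c (Inr e) = c (Inr e')" for e e' v
  proof -
    obtain u where u: "ends G e = {v, u}" "v \<noteq> u" "v \<in> verts G" "u \<in> verts G" "c (Inr e) = g (p e) v u"
      using edge[OF e(1) v(1)] by blast
    obtain u' where u': "ends G e' = {v, u'}" "v \<noteq> u'" "u' \<in> verts G" "c (Inr e') = g (p e') v u'"
      using edge[OF e(2) v(2)] by blast
    have "p e = p e'" and "k v u = k v u' \<or> f v u = f v u'"
      using eq u(5) u'(4) by (auto simp: g_def split: if_splits)
    moreover from this(2) have "u = u'"
      using complete_harmoniousD(3)[OF k u(3,4,2) u'(3,2)] f_inj[OF u(3,4) u'(3) u(2) u'(2)] by blast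
    ultimately show ?thesis
      using p_inj e u(1) u'(1) by simp
  qed
  have antisym: False if e: "e \<in> edges G" "e' \<in> edges G" and v: "v \<in> ends G e" "v' \<in> ends G e'"
    and eq: "c (Inr e) = c (Inl v')" "c (Inr e') = c (Inl v)" for e e' v v'
  proof -
    obtain u where u: "v \<noteq> u" "v \<in> verts G" "u \<in> verts G" "c (Inr e) = g (p e) v u"
      using edge[OF e(1) v(1)] by blast
    obtain u' where u': "v' \<noteq> u'" "v' \<in> verts G" "u' \<in> verts G" "c (Inr e') = g (p e') v' u'"
      using edge[OF e(2) v(2)] by blast
    have "k v u = Inl v'" "k v' u' = Inl v"
      using eq u(4) u'(4) by (auto simp: g_def c_def split: if_splits)
    then show False
      using complete_harmoniousD(4)[OF k u(2,3,1) u'(2,3,1)] by blast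
  qed
  have "total_colouring G c"
    unfolding total_colouring_def
  proof (intro conjI allI impI ballI)
    fix u v assume "adjacent_verts G u v"
    then show "c (Inl u) \<noteq> c (Inl v)" by (simp add: adjacent_verts_def c_def)
  next
    fix e e' assume "adjacent_edges G e e'"
    then show "c (Inr e) \<noteq> c (Inr e')"
      using proper unfolding adjacent_edges_def by blast
  next
    fix x assume "x \<in> incident_pairs G"
    then show "case x of (v, e) \<Rightarrow> c (Inl v) \<noteq> c (Inr e)"
      using antisym unfolding incident_pairs_def by fastforce
  qed
  moreover have "inj_on (\<lambda>(v, e). {c (Inl v), c (Inr e)}) (incident_pairs G)"
  proof (rule inj_onI)
    fix x y assume xy: "x \<in> incident_pairs G" "y \<in> incident_pairs G"
      and eq: "(\<lambda>(v, e). {c (Inl v), c (Inr e)}) x = (\<lambda>(v, e). {c (Inl v), c (Inr e)}) y"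
    obtain v e where x: "x = (v, e)" by (cases x)
    obtain v' e' where y: "y = (v', e')" by (cases y)
    have inc: "e \<in> edges G" "e' \<in> edges G" "v \<in> ends G e" "v' \<in> ends G e'"
      using xy by (auto simp: incident_pairs_def x y)
    have "c (Inl v) = c (Inl v') \<and> c (Inr e) = c (Inr e') \<or>
        c (Inl v) = c (Inr e') \<and> c (Inr e) = c (Inl v')"
      using eq by (simp add: x y doubleton_eq_iff)
    then show "x = y"
    proof
      assume *: "c (Inl v) = c (Inl v') \<and> c (Inr e) = c (Inr e')"
      then have "v = v'" by (simp add: c_def)
      then show ?thesis using proper[of e e' v] inc * by (simp add: x y)
    next
      assume *: "c (Inl v) = c (Inr e') \<and> c (Inr e) = c (Inl v')"
      then show ?thesis using antisym[OF inc(1,2) inc(3,4)] by simp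
    qed
  qed
  ultimately have "harmonious_total_colouring G c"
    by (simp add: harmonious_total_colouring_def)
  then have "harmonious_total_chromatic_number G \<le> num_colours G c"
    by (rule harmonious_total_chromatic_number_le)
  also have "\<dots> \<le> card ((verts G <+> {..<q}) <+> {1..<max_multiplicity G} \<times> {..<N})"
    unfolding num_colours_def
  proof (rule card_mono)
    show "finite ((verts G <+> {..<q}) <+> {1..<max_multiplicity G} \<times> {..<N})"
      using finite_verts by simp
    show "c ` (verts G <+> edges G) \<subseteq> (verts G <+> {..<q}) <+> {1..<max_multiplicity G} \<times> {..<N}"
    proof clarify
      fix x assume "x \<in> verts G <+> edges G"
      then show "c x \<in> (verts G <+> {..<q}) <+> {1..<max_multiplicity G} \<times> {..<N}"
      proof (rule PlusE)
        fix v assume "v \<in> verts G" "x = Inl v"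
        then show ?thesis by (auto simp: c_def)
      next
        fix e assume e: "e \<in> edges G" "x = Inr e"
        obtain v where "v \<in> ends G e" using r[OF e(1)] by blast
        then obtain u where u: "v \<noteq> u" "v \<in> verts G" "u \<in> verts G" "c (Inr e) = g (p e) v u"
          using edge[OF e(1)] by blast
        show ?thesis
        proof (cases "p e = 0")
          case True
          then show ?thesis
            using u complete_harmoniousD(2)[OF k u(2,3,1)] e(2) by (simp add: g_def InlI)
        next
          case False
          then show ?thesis
            using u(4) f[OF u(2,3,1)] p[OF e(1)] e(2) by (simp add: g_def InrI)
        qed
      qed
    qed
  qed
  also have "\<dots> = card (verts G) + q + (max_multiplicity G - 1) * N"
    using finite_verts by (simp add: card_Plus card_cartesian_product)
  finally show ?thesis by (simp add: N_def)
qed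

lemma max_multiplicity_0_imp_no_edges:
  assumes "max_multiplicity G = 0"
  shows "edges G = {}"
proof (rule ccontr)
  assume "edges G \<noteq> {}"
  then obtain e where "e \<in> edges G" by blast
  then show False
    using parallel_index assms by (metis not_less0)
qed

lemma harmonious_total_chromatic_number_no_edges:
  assumes "edges G = {}"
  shows "harmonious_total_chromatic_number G \<le> 1"
proof -
  have "harmonious_total_colouring G (\<lambda>_. ())"
    using assms by (simp add: harmonious_total_colouring_def total_colouring_def incident_pairs_def
        adjacent_verts_def adjacent_edges_def)
  then have "harmonious_total_chromatic_number G \<le> num_colours G (\<lambda>_. ())"
    by (rule harmonious_total_chromatic_number_le)
  also have "\<dots> \<le> card (UNIV :: unit set)"
    unfolding num_colours_def by (rule card_mono) auto
  finally show ?thesis by simp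
qed

end

text \<open>
  With \<open>q = \<lceil>n/2\<rceil>\<close> one has \<open>\<lceil>3n/2\<rceil> = n + q\<close>. For \<open>\<lambda> = 0\<close> the right-hand side is \<open>n - q + 1\<close> and one colour
  is enough.
\<close>

theorem corollary5:
  fixes G :: "('v, 'e) pre_multigraph" and n :: nat and lam :: nat
  assumes "multigraph G"
    and "order G = n"
    and "n \<ge> 2"
    and "n \<noteq> 4"
    and "max_multiplicity G = lam"
  shows "int (harmonious_total_chromatic_number G)
    \<le> (int lam - 1) * (2 * \<lceil>real n / 2\<rceil> - 1) + \<lceil>3 * real n / 2\<rceil>"
proof -
  interpret multigraph G by fact
  define q where "q = (n + 1) div 2"
  have n: "card (verts G) = n"
    using assms(2) by (simp add: order_def)
  have "2 * q = n \<or> 2 * q = n + 1"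
    by (auto simp: q_def)
  then have half: "\<lceil>real n / 2\<rceil> = int q" and three_halves: "\<lceil>3 * real n / 2\<rceil> = int (n + q)"
    by (auto simp: ceiling_eq_iff)
  have q: "1 \<le> q" "q \<le> n"
    using assms(3) by (auto simp: q_def)
  show ?thesis
  proof (cases "lam = 0")
    case True
    then have "harmonious_total_chromatic_number G \<le> 1"
      using assms(5) max_multiplicity_0_imp_no_edges harmonious_total_chromatic_number_no_edges by simp
    then show ?thesis
      using True q by (simp add: half three_halves)
  next
    case False
    obtain k where k: "complete_harmonious (verts G) q k"
      using complete_harmonious_exists[OF finite_verts] assms(3,4) unfolding q_def n by blast
    have "harmonious_total_chromatic_number G \<le> n + q + (lam - 1) * (2 * q - 1)"
      using harmonious_total_chromatic_number_bound[OF k] assms(3,5) by (simp add: n q_def)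
    then have "int (harmonious_total_chromatic_number G) \<le> int (n + q + (lam - 1) * (2 * q - 1))"
      by (simp only: of_nat_le_iff)
    also have "\<dots> = (int lam - 1) * (2 * int q - 1) + int (n + q)"
      using False q by (simp add: of_nat_diff)
    finally show ?thesis
      by (simp only: half three_halves)
  qed
qed

end
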